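(* Let $m,n$ be positive integers with $n$ even. Then the bar visibility number of the complete bipartite graph $K_{m,n}$ satisfies $b(K_{m,n})=\left\lceil \frac{mn+4}{2m+2n}\right\rceil$.
   Context: A bar is a horizontal line segment in the plane. A $t$-bar visibility representation of a graph $G$ assigns to each vertex of $G$ at most $t$ pairwise disjoint bars so that two vertices are adjacent if and only if some bar assigned to one of them sees some bar assigned to the other, where two bars see each other if there is an unobstructed vertical channel of positive width between them (an axis-parallel rectangle of positive width with bottom side in one bar, top side in the other, and interior meeting no other bar). The bar visibility number $b(G)$ is the least $t$ such that $G$ has a $t$-bar visibility representation. *)

theory Defs
  imports "HOL-Analysis.Analysis" "Graph_Theory.Kuratowski"
begin

text \<open>
  Finite simple graphs are loop-free symmetric digraphs without parallel arcs
  (locale \<^locale>\<open>graph\<close>), and \<open>u \<rightarrow>\<^bsub>G\<^esub> v\<close> is adjacency.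
\<close>

definition bar :: "(real \<times> real) set \<Rightarrow> bool" where
  "bar B \<longleftrightarrow> (\<exists>l r y. l < r \<and> B = {l..r} \<times> {y})"

text \<open>
  An unobstructed channel \<open>[a,b] \<times> [c,d]\<close> with bottom side in \<open>B\<close> and top side in \<open>C\<close>;
  \<open>\<B>\<close> is the set of all bars in the plane, any of which may obstruct the channel.
\<close>

definition channel :: "(real \<times> real) set set \<Rightarrow> (real \<times> real) set \<Rightarrow> (real \<times> real) set \<Rightarrow> bool" where
  "channel \<B> B C \<longleftrightarrow> (\<exists>a b c d. a < b \<and> c < d \<and>
     {a..b} \<times> {c} \<subseteq> B \<and> {a..b} \<times> {d} \<subseteq> C \<and>
     (\<forall>D \<in> \<B> - {B, C}. D \<inter> ({a<..<b} \<times> {c<..<d}) = {}))"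

definition sees :: "(real \<times> real) set set \<Rightarrow> (real \<times> real) set \<Rightarrow> (real \<times> real) set \<Rightarrow> bool" where
  "sees \<B> B C \<longleftrightarrow> channel \<B> B C \<or> channel \<B> C B"

text \<open>
  Disjointness is required of all bars in the representation, not only of those assigned to the
  same vertex. Otherwise \<open>K\<^bsub>m,n\<^esub>\<close> would always have a representation with one bar per vertex,
  by stacking the bars of each side of the bipartition on top of each other at the same height.
  Bars assigned to the same vertex may see each other.
\<close>

definition bar_visibility_rep ::
  "nat \<Rightarrow> ('a, 'b) pre_digraph \<Rightarrow> ('a \<Rightarrow> (real \<times> real) set set) \<Rightarrow> bool" where
  "bar_visibility_rep t G f \<longleftrightarrow>
     (\<forall>v \<in> verts G. finite (f v) \<and> card (f v) \<le> t \<and> (\<forall>B \<in> f v. bar B)) \<and>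
     (\<forall>u \<in> verts G. \<forall>v \<in> verts G. \<forall>B \<in> f u. \<forall>C \<in> f v. (u, B) \<noteq> (v, C) \<longrightarrow> B \<inter> C = {}) \<and>
     (\<forall>u \<in> verts G. \<forall>v \<in> verts G. u \<noteq> v \<longrightarrow>
        (u \<rightarrow>\<^bsub>G\<^esub> v \<longleftrightarrow> (\<exists>B \<in> f u. \<exists>C \<in> f v. sees (\<Union>w \<in> verts G. f w) B C)))"

definition bar_visibility_number :: "('a, 'b) pre_digraph \<Rightarrow> nat" where
  "bar_visibility_number G = (LEAST t. \<exists>f. bar_visibility_rep t G f)"

end

theory Submission
  imports Defs
begin

text \<open>
  Lower bound. Colour the bars by the two sides of the bipartition and sweep a vertical line over them, inserting and
  removing one bar at a time. Among a bar and its two neighbours on the line at most two of the three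
  pairs are bicoloured, so each of the \<open>2N\<close> steps creates or destroys at most two bicoloured consecutive pairs, and
  the steps at both ends of the sweep even fewer. Each visible pair is created and destroyed, so \<open>mn \<le> 2N - 3\<close>,
  and as \<open>n\<close> is even, \<open>mn \<le> 2N - 4\<close>.

  Upper bound. Let \<open>n = 2p\<close>. Dissect a disk with at most \<open>tm\<close> points on the boundary circle into \<open>tp\<close> polygons
  and double it along the circle. A polygon becomes two vertices on the two sides of the circle, so that with labels
  in \<open>{0..<m}\<close> and \<open>{0..<p}\<close> it remains to let each pair of labels occur as a polygon and one of its
  corners. Number the corners cyclically and let all polygons have consecutive corners. The \<open>tp - 1\<close> chords
  \<open>{c - 1, c}\<close> between polygons are distributed evenly over the residues \<open>c\<close>; since
  \<open>2 (tp - 1) \<ge> (p - t) m\<close>, every corner label then lies on at least \<open>p - t\<close> of them, hence in \<open>p\<close> polygons.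
  If the polygons are sorted cyclically by first and last chord simultaneously, then those
  containing a given corner are consecutive, and labelling them in turn by \<open>0, \<dots>, p - 1\<close> is as required. As in Euler's
  theorem, the polygons form a trail and cycles, and the cycles can be inserted into the trail.
\<close>

section \<open>Sweeping over the bars\<close>

text \<open>The bounds meet because both count the edges of a planar bipartite graph. Cutting a disk
  with \<open>tm\<close> boundary points by \<open>tp - 1\<close> chords into \<open>tp\<close>
  polygons gives \<open>tm + 2 (tp - 1)\<close> incidences of a polygon with a corner, and doubling
  gives twice as many edges on \<open>N = tm + 2tp\<close> vertices, that is \<open>2N - 4\<close>.
  All \<open>mp\<close> pairs of labels can occur only if \<open>mp \<le> tm + 2 (tp - 1)\<close>.
  This is the inequality \<open>(p - t) m \<le> 2 (tp - 1)\<close>, and for \<open>n = 2p\<close> it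
  says the same as \<open>mn + 4 \<le> 2t (m + n)\<close>. In the case of equality no pair of labels
  may occur twice, hence the even distribution of the chords and the cyclic labelling. A corner
  label on \<open>t\<close> boundary points and on \<open>d\<close> chords lies in
  \<open>t + d\<close> polygons, counted with multiplicity; this is the origin of
  \<open>p - t\<close>. What cannot be prescribed directly is that polygons with the chosen first
  and last chords fit together into one disk: only the numbers of first and last chords are under
  control, which is why Euler trails enter.\<close>

definition consec :: "('b \<Rightarrow> real) \<Rightarrow> 'b set \<Rightarrow> 'b \<Rightarrow> 'b \<Rightarrow> bool" where
  "consec h S u v \<longleftrightarrow> u \<in> S \<and> v \<in> S \<and> h u < h v \<and> (\<forall>w \<in> S. \<not> (h u < h w \<and> h w < h v))"

definition bicoloured :: "('b \<Rightarrow> real) \<Rightarrow> ('b \<Rightarrow> bool) \<Rightarrow> 'b set \<Rightarrow> ('b \<times> 'b) set" where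
  "bicoloured h c S = {(u, v). consec h S u v \<and> c u \<noteq> c v}"

lemma bicoloured_subset: "bicoloured h c S \<subseteq> S \<times> S"
  by (auto simp: bicoloured_def consec_def)

lemma bicoloured_singleton: "bicoloured h c {w} = {}"
  by (auto simp: bicoloured_def consec_def)

lemma bicoloured_empty: "bicoloured h c {} = {}"
  by (auto simp: bicoloured_def consec_def)

lemma card_bicoloured_doubleton: "card (bicoloured h c {u, v}) \<le> 1"
proof -
  have "bicoloured h c {u, v} \<subseteq> (if h u < h v then {(u, v)} else {(v, u)})"
    by (auto simp: bicoloured_def consec_def)
  then have "card (bicoloured h c {u, v}) \<le> card (if h u < h v then {(u, v)} else {(v, u)})"
    by (rule card_mono[rotated]) simp
  then show ?thesis by (simp split: if_splits)
qed

lemma card_sym_diff_bicoloured_insert: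
  assumes inj: "inj_on h (insert w S)" and w: "w \<notin> S"
  shows "card (sym_diff (bicoloured h c S) (bicoloured h c (insert w S))) \<le> 2"
proof -
  let ?I = "insert w S"
  let ?D = "sym_diff (bicoloured h c S) (bicoloured h c ?I)"
  \<comment> \<open>\<open>P\<close> and \<open>Q\<close> have at most one element each, the lower
    and the upper neighbour of \<open>w\<close>.\<close>
  define P where "P = {x. consec h ?I x w}"
  define Q where "Q = {y. consec h ?I w y}"
  have P1: "x = x'" if "x \<in> P" "x' \<in> P" for x x'
  proof -
    have "h x = h x'" using that unfolding P_def consec_def by force
    then show ?thesis using that inj unfolding P_def consec_def inj_on_def by blast
  qed
  have Q1: "x = x'" if "x \<in> Q" "x' \<in> Q" for x x'
  proof -
    have "h x = h x'" using that unfolding Q_def consec_def by force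
    then show ?thesis using that inj unfolding Q_def consec_def inj_on_def by blast
  qed
  have sub: "?D \<subseteq> (P \<times> {w} \<union> {w} \<times> Q \<union> P \<times> Q) \<inter> {(u, v). c u \<noteq> c v}"
  proof
    fix e assume e: "e \<in> ?D"
    obtain u v where uv: "e = (u, v)" by fastforce
    from e uv have cuv: "c u \<noteq> c v" by (auto simp: bicoloured_def)
    consider "consec h S u v" "\<not> consec h ?I u v" | "consec h ?I u v" "\<not> consec h S u v"
      using e uv cuv by (auto simp: bicoloured_def)
    then show "e \<in> (P \<times> {w} \<union> {w} \<times> Q \<union> P \<times> Q) \<inter> {(u, v). c u \<noteq> c v}"
    proof cases
      case 1
      then have "h u < h w" "h w < h v" by (auto simp: consec_def)
      with 1 have "u \<in> P" "v \<in> Q" by (fastforce simp: consec_def P_def Q_def)+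
      with uv cuv show ?thesis by auto
    next
      case 2
      then have "u = w \<or> v = w" by (auto simp: consec_def)
      with 2 uv cuv show ?thesis by (auto simp: P_def Q_def)
    qed
  qed
  have "\<exists>e f. (P \<times> {w} \<union> {w} \<times> Q \<union> P \<times> Q) \<inter> {(u, v). c u \<noteq> c v} \<subseteq> {e, f}"
  proof (cases "P = {} \<or> Q = {}")
    case True
    show ?thesis
    proof (cases "P = {}")
      case True
      show ?thesis
      proof (cases "Q = {}")
        case True with \<open>P = {}\<close> show ?thesis by auto
      next
        case False
        then obtain y where "Q = {y}" using Q1 by blast
        with \<open>P = {}\<close> show ?thesis by auto
      qed
    next
      case False
      then obtain x where "P = {x}" using P1 by blast
      with \<open>P = {} \<or> Q = {}\<close> show ?thesis by auto
    qed
  next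
    case False
    then obtain x y where xy: "P = {x}" "Q = {y}" using P1 Q1 by blast
    show ?thesis
    proof (cases "c x = c w")
      case True
      then have "(P \<times> {w} \<union> {w} \<times> Q \<union> P \<times> Q) \<inter> {(u, v). c u \<noteq> c v} \<subseteq> {(w, y), (x, y)}"
        using xy by auto
      then show ?thesis by blast
    next
      case F: False
      show ?thesis
      proof (cases "c w = c y")
        case True
        then have "(P \<times> {w} \<union> {w} \<times> Q \<union> P \<times> Q) \<inter> {(u, v). c u \<noteq> c v} \<subseteq> {(x, w), (x, y)}"
          using xy by auto
        then show ?thesis by blast
      next
        case False
        with F have "(P \<times> {w} \<union> {w} \<times> Q \<union> P \<times> Q) \<inter> {(u, v). c u \<noteq> c v} \<subseteq> {(x, w), (w, y)}"
          using xy by auto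
        then show ?thesis by blast
      qed
    qed
  qed
  then obtain e f where "(P \<times> {w} \<union> {w} \<times> Q \<union> P \<times> Q) \<inter> {(u, v). c u \<noteq> c v} \<subseteq> {e, f}"
    by (elim exE)
  with sub have "?D \<subseteq> {e, f}" by (rule subset_trans)
  then have "card ?D \<le> card {e, f}" by (intro card_mono) auto
  also have "\<dots> \<le> 2" by (simp add: card_insert_if)
  finally show ?thesis .
qed

lemma last_change:
  fixes k :: nat
  assumes "\<not> P 0" "P k"
  shows "\<exists>i<k. \<not> P i \<and> P (Suc i)"
  using assms
proof (induction k)
  case (Suc k) then show ?case by (cases "P k") (auto intro: less_SucI)
qed auto

lemma first_change:
  fixes k M :: nat
  assumes "P k" "\<not> P M" "k \<le> M"
  shows "\<exists>i. k \<le> i \<and> i < M \<and> P i \<and> \<not> P (Suc i)"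
  using assms
proof (induction M)
  case 0 then show ?case by auto
next
  case (Suc M)
  then show ?case by (cases "P M") (auto simp: le_Suc_eq intro: less_SucI)
qed

text \<open>Double counting: an element of the union enters at some step and, since the sequence
  starts and ends empty, leaves at another one. So it lies in at least two of the symmetric
  differences.\<close>

lemma double_card_Union_le:
  fixes X :: "nat \<Rightarrow> 'e set"
  assumes "X 0 = {}" "X M = {}" and fin: "\<And>i. i \<le> M \<Longrightarrow> finite (X i)"
  shows "2 * card (\<Union>i\<le>M. X i) \<le> (\<Sum>i<M. card (sym_diff (X i) (X (Suc i))))"
proof -
  let ?U = "\<Union>i\<le>M. X i" and ?d = "\<lambda>i. sym_diff (X i) (X (Suc i))"
  have finU: "finite ?U" using fin by auto
  have two: "2 \<le> card {i\<in>{..<M}. e \<in> ?d i}" if "e \<in> ?U" for e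
  proof -
    obtain k where k: "k \<le> M" "e \<in> X k" using \<open>e \<in> ?U\<close> by auto
    obtain i where i: "i < k" "e \<notin> X i" "e \<in> X (Suc i)"
      using last_change[of "\<lambda>i. e \<in> X i" k] assms(1) k by auto
    obtain j where j: "k \<le> j" "j < M" "e \<in> X j" "e \<notin> X (Suc j)"
      using first_change[of "\<lambda>i. e \<in> X i" k M] assms(2) k by auto
    have "{i, j} \<subseteq> {i\<in>{..<M}. e \<in> ?d i}" using i j k by auto
    then have "card {i, j} \<le> card {i\<in>{..<M}. e \<in> ?d i}" by (intro card_mono) auto
    with i j show ?thesis by auto
  qed
  have "2 * card ?U = (\<Sum>e\<in>?U. 2)" by simp
  also have "\<dots> \<le> (\<Sum>e\<in>?U. card {i\<in>{..<M}. e \<in> ?d i})" by (intro sum_mono two)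
  also have "\<dots> = (\<Sum>i<M. card {e\<in>?U. e \<in> ?d i})"
    using sum_multicount_gen[OF finU, of "{..<M}" "\<lambda>e i. e \<in> ?d i" "\<lambda>i. card {e\<in>?U. e \<in> ?d i}"]
    by auto
  also have "\<dots> = (\<Sum>i<M. card (?d i))"
  proof (rule sum.cong[OF refl])
    fix i assume "i \<in> {..<M}"
    then have "{e\<in>?U. e \<in> ?d i} = ?d i" by (auto intro: bexI[of _ "Suc i"] bexI[of _ i])
    then show "card {e\<in>?U. e \<in> ?d i} = card (?d i)" by simp
  qed
  finally show ?thesis .
qed

text \<open>The first and the last step contribute nothing, the second step at most 1 and the other
  \<open>M - 3\<close> steps at most 2 each, in total \<open>2 * M - 5\<close>. By parity this is as
  good as the \<open>2 * M - 6\<close> that the symmetric saving near the end would give.\<close>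

lemma card_Union_bicoloured_le:
  fixes h :: "'b \<Rightarrow> real" and S :: "nat \<Rightarrow> 'b set"
  assumes S0: "S 0 = {}" and SM: "S M = {}" and M: "3 \<le> M"
    and inj: "\<And>i. inj_on h (S i)" and fin: "\<And>i. finite (S i)"
    and step: "\<And>i. i < M \<Longrightarrow> \<exists>w. (w \<notin> S i \<and> S (Suc i) = insert w (S i)) \<or> (w \<notin> S (Suc i) \<and> S i = insert w (S (Suc i)))"
  shows "2 * card (\<Union>i\<le>M. bicoloured h c (S i)) + 5 \<le> 2 * M"
proof -
  let ?d = "\<lambda>i. card (sym_diff (bicoloured h c (S i)) (bicoloured h c (S (Suc i))))"
  have fin_bicoloured: "finite (bicoloured h c (S i))" for i
    by (rule finite_subset[OF bicoloured_subset]) (simp add: fin)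
  have le2: "?d i \<le> 2" if "i < M" for i
  proof -
    from step[OF that] obtain w where "(w \<notin> S i \<and> S (Suc i) = insert w (S i)) \<or> (w \<notin> S (Suc i) \<and> S i = insert w (S (Suc i)))" ..
    then show ?thesis
      using card_sym_diff_bicoloured_insert[of h w "S i" c] card_sym_diff_bicoloured_insert[of h w "S (Suc i)" c]
        inj[of i] inj[of "Suc i"] by (elim disjE conjE) (simp_all add: Un_commute)
  qed
  obtain w1 where S1: "S (Suc 0) = {w1}" using step[of 0] S0 M by auto
  have d0: "?d 0 = 0" using S0 S1 by (simp add: bicoloured_singleton bicoloured_empty)
  obtain wl where "S (M - 1) = {wl}" using step[of "M - 1"] SM M by auto
  then have dl: "?d (M - 1) = 0" using SM M by (simp add: bicoloured_singleton bicoloured_empty)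
  have d1: "?d 1 \<le> 1"
  proof -
    have "S (Suc 1) = {} \<or> (\<exists>w. S (Suc 1) = {w, w1})" using step[of 1] S1 M by (auto simp: insert_eq_iff)
    then show ?thesis using S1 card_bicoloured_doubleton[of h c] by (auto simp: bicoloured_singleton bicoloured_empty)
  qed
  have "2 * card (\<Union>i\<le>M. bicoloured h c (S i)) \<le> (\<Sum>i<M. ?d i)"
    by (intro double_card_Union_le) (auto simp: S0 SM bicoloured_empty fin_bicoloured)
  also have "\<dots> = ?d 0 + ?d 1 + ?d (M - 1) + (\<Sum>i\<in>{..<M} - {0, 1, M - 1}. ?d i)"
  proof -
    have "(\<Sum>i<M. ?d i) = (\<Sum>i\<in>{0,1,M-1}. ?d i) + (\<Sum>i\<in>{..<M} - {0, 1, M - 1}. ?d i)"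
      using M by (subst sum.subset_diff[of "{0,1,M-1}"]) (auto simp: add.commute)
    also have "(\<Sum>i\<in>{0,1,M-1}. ?d i) = ?d 0 + ?d 1 + ?d (M - 1)"
      using M by simp
    finally show ?thesis .
  qed
  also have "\<dots> \<le> 0 + 1 + 0 + (\<Sum>i\<in>{..<M} - {0, 1, M - 1}. 2)"
    using d0 d1 dl le2 by (intro add_mono sum_mono) auto
  also have "\<dots> = 1 + 2 * (M - 3)"
  proof -
    have "card ({..<M} - {0, 1, M - 1}) = M - 3"
      using M by (subst card_Diff_subset) auto
    then show ?thesis by simp
  qed
  finally show ?thesis using M by simp
qed

section \<open>The sweep over a representation and the lower bound\<close>

lemma ex_sorted_list_lex:
  fixes p q :: "'e \<Rightarrow> real"
  assumes "finite A"
  shows "\<exists>xs. distinct xs \<and> set xs = A \<and> sorted_wrt (\<lambda>e f. p e < p f \<or> p e = p f \<and> q e \<le> q f) xs"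
proof -
  define lt where "lt e f \<longleftrightarrow> p e < p f \<or> p e = p f \<and> q e < q f" for e f
  \<comment> \<open>The rank, the number of lexicographically smaller elements, merges both keys
    into one for \<open>sort_key\<close>.\<close>
  define rk where "rk f = card {e \<in> A. lt e f}" for f
  obtain ys where ys: "distinct ys" "set ys = A" using finite_distinct_list[OF assms] by blast
  define xs where "xs = sort_key rk ys"
  have mono: "rk e < rk f" if "lt e f" "e \<in> A" for e f
    unfolding rk_def
  proof (rule psubset_card_mono)
    show "finite {e \<in> A. lt e f}" using assms by simp
    have "{x \<in> A. lt x e} \<subseteq> {e \<in> A. lt e f}" using that by (auto simp: lt_def)
    moreover have "e \<in> {e \<in> A. lt e f}" "e \<notin> {x \<in> A. lt x e}" using that by (auto simp: lt_def)
    ultimately show "{x \<in> A. lt x e} \<subset> {e \<in> A. lt e f}" by blast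
  qed
  have "sorted_wrt (\<lambda>e f. rk e \<le> rk f) xs" 
    using sorted_sort_key[of rk ys] by (simp add: xs_def sorted_map)
  then have "sorted_wrt (\<lambda>e f. p e < p f \<or> p e = p f \<and> q e \<le> q f) xs"
  proof (rule sorted_wrt_mono_rel[rotated])
    fix e f assume "e \<in> set xs" "f \<in> set xs" "rk e \<le> rk f"
    then have "\<not> lt f e" using mono[of f e] ys by (auto simp: xs_def)
    then show "p e < p f \<or> p e = p f \<and> q e \<le> q f" by (auto simp: lt_def)
  qed
  then show ?thesis using ys by (intro exI[of _ xs]) (simp add: xs_def)
qed

lemma channelE:
  assumes "channel \<B> B C" "B = {l1..r1} \<times> {y1}" "C = {l2..r2} \<times> {y2}"
  obtains a b where "a < b" "l1 \<le> a" "b \<le> r1" "l2 \<le> a" "b \<le> r2" "y1 < y2"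
    "\<And>D x y. D \<in> \<B> \<Longrightarrow> D \<noteq> B \<Longrightarrow> D \<noteq> C \<Longrightarrow> a < x \<Longrightarrow> x < b \<Longrightarrow> y1 < y \<Longrightarrow> y < y2 \<Longrightarrow> (x, y) \<notin> D"
proof -
  from assms(1) obtain a b c d where *: "a < b \<and> c < d \<and> {a..b} \<times> {c} \<subseteq> B \<and> {a..b} \<times> {d} \<subseteq> C \<and>
     (\<forall>D \<in> \<B> - {B, C}. D \<inter> ({a<..<b} \<times> {c<..<d}) = {})" unfolding channel_def by (elim exE)
  then have sub: "{a..b} \<times> {c} \<subseteq> {l1..r1} \<times> {y1}" "{a..b} \<times> {d} \<subseteq> {l2..r2} \<times> {y2}"
    using assms(2,3) by simp_all
  have "(a, c) \<in> {a..b} \<times> {c}" "(b, c) \<in> {a..b} \<times> {c}" "(a, d) \<in> {a..b} \<times> {d}" "(b, d) \<in> {a..b} \<times> {d}"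
    using * by simp_all
  with sub have "(a, c) \<in> {l1..r1} \<times> {y1}" "(b, c) \<in> {l1..r1} \<times> {y1}"
    "(a, d) \<in> {l2..r2} \<times> {y2}" "(b, d) \<in> {l2..r2} \<times> {y2}"
    by (meson subsetD)+
  then have le: "l1 \<le> a" "b \<le> r1" "l2 \<le> a" "b \<le> r2" and y: "c = y1" "d = y2" by simp_all
  show ?thesis
  proof (rule that[OF _ le])
    show "a < b" "y1 < y2" using * y by simp_all
    fix D x z assume "D \<in> \<B>" "D \<noteq> B" "D \<noteq> C" and x: "a < x" "x < b" "y1 < z" "z < y2"
    then have "D \<inter> ({a<..<b} \<times> {c<..<d}) = {}" using * by simp
    moreover have "(x, z) \<in> {a<..<b} \<times> {c<..<d}" using x y by simp
    ultimately show "(x, z) \<notin> D" by blast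
  qed
qed

text \<open>A bicoloured visible pair is consecutive at the moment when the line runs through its
  channel. With \<open>2 * card \<B>\<close> events the sweep gives
  \<open>2 * card F + 5 \<le> 4 * card \<B>\<close>, and parity yields the constant 3.\<close>

lemma card_visible_pairs_le:
  assumes fin: "finite \<B>" and bars: "\<And>B. B \<in> \<B> \<Longrightarrow> bar B"
    and disj: "\<And>B C. B \<in> \<B> \<Longrightarrow> C \<in> \<B> \<Longrightarrow> B \<noteq> C \<Longrightarrow> B \<inter> C = {}"
    and two: "2 \<le> card \<B>"
    and F: "F \<subseteq> {(B, C). B \<in> \<B> \<and> C \<in> \<B> \<and> c B \<and> \<not> c C \<and> sees \<B> B C}"
  shows "card F + 3 \<le> 2 * card \<B>"
proof -
  have "\<forall>B\<in>\<B>. \<exists>q. fst q < fst (snd q) \<and> B = {fst q..fst (snd q)} \<times> {snd (snd q)}"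
    using bars unfolding bar_def by force
  then obtain q where q: "\<forall>B\<in>\<B>. fst (q B) < fst (snd (q B)) \<and> B = {fst (q B)..fst (snd (q B))} \<times> {snd (snd (q B))}"
    by (rule bchoice[THEN exE])
  define l where "l B = fst (q B)" for B
  define r where "r B = fst (snd (q B))" for B
  define y where "y B = snd (snd (q B))" for B
  have lry: "l B < r B" "B = {l B..r B} \<times> {y B}" if "B \<in> \<B>" for B
    using bspec[OF q that] by (simp_all add: l_def r_def y_def)
  \<comment> \<open>An event is a bar with \<open>True\<close> for its left and \<open>False\<close>
    for its right end; at equal positions the right ends come first.\<close>
  define Ev where "Ev = \<B> \<times> (UNIV :: bool set)"
  define pos where "pos = (\<lambda>(B, s). if s then l B else r B)"
  define kind :: "(real \<times> real) set \<times> bool \<Rightarrow> real" where "kind = (\<lambda>(B, s). if s then 1 else 0)"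
  have "finite Ev" using fin by (simp add: Ev_def)
  then obtain es where es: "distinct es" "set es = Ev"
      "sorted_wrt (\<lambda>e f. pos e < pos f \<or> pos e = pos f \<and> kind e \<le> kind f) es"
    by (elim ex_sorted_list_lex[of Ev pos kind, THEN exE] conjE)
  define M where "M = length es"
  have M2: "M = 2 * card \<B>"
    using es(2) distinct_card[OF es(1)] by (simp add: M_def Ev_def card_cartesian_product mult.commute)
  define S where "S j = {B \<in> \<B>. (B, True) \<in> set (take j es) \<and> (B, False) \<notin> set (take j es)}" for j
  have earlier: "e \<in> set (take j es)" if ef: "e \<in> Ev" "f \<in> set (take j es)" "pos e < pos f \<or> pos e = pos f \<and> kind e < kind f" for e f j
  proof -
    obtain i where i: "i < length es" "es ! i = e" using ef(1) es(2) by (metis in_set_conv_nth)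
    obtain k where k: "k < j" "k < length es" "es ! k = f" using ef(2)
      by (auto simp: in_set_conv_nth)
    have "\<not> k < i" using sorted_wrt_nth_less[OF es(3), of k i] i k ef(3) by auto
    moreover have "i \<noteq> k" using i k ef(3) by auto
    ultimately have "i < j" using k by simp
    then have "take j es ! i = e" "i < length (take j es)" using i by simp_all
    then show ?thesis by (metis nth_mem)
  qed
  have take_Suc: "set (take (Suc j) es) = insert (es ! j) (set (take j es))" "es ! j \<notin> set (take j es)" "es ! j \<in> Ev" if "j < M" for j
  proof -
    have *: "take (Suc j) es = take j es @ [es ! j]" using that by (simp add: M_def take_Suc_conv_app_nth)
    then show "set (take (Suc j) es) = insert (es ! j) (set (take j es))" by simp
    have "distinct (take (Suc j) es)" using es(1) by (rule distinct_take)
    then show "es ! j \<notin> set (take j es)" using * by simp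
    show "es ! j \<in> Ev" using that es(2) nth_mem M_def by blast
  qed
  have step: "\<exists>w. (w \<notin> S j \<and> S (Suc j) = insert w (S j)) \<or> (w \<notin> S (Suc j) \<and> S j = insert w (S (Suc j)))"
    if "j < M" for j
  proof -
    note t = take_Suc[OF that]
    obtain B s where Bs: "es ! j = (B, s)" by fastforce
    with t have B: "B \<in> \<B>" by (auto simp: Ev_def)
    show ?thesis
    proof (cases s)
      case True
      have "(B, False) \<notin> set (take j es)"
        using earlier[of "(B, True)" "(B, False)" j] t Bs True lry(1)[OF B] by (auto simp: pos_def)
      then have "B \<notin> S j" "S (Suc j) = insert B (S j)"
        using t Bs True B by (auto simp: S_def)
      then show ?thesis by blast
    next
      case False
      have "(B, True) \<in> set (take (Suc j) es)"
        using earlier[of "(B, True)" "(B, False)" "Suc j"] t Bs False lry(1)[OF B] B by (auto simp: pos_def Ev_def)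
      then have "B \<notin> S (Suc j)" "S j = insert B (S (Suc j))"
        using t Bs False B by (auto simp: S_def)
      then show ?thesis by blast
    qed
  qed
  have inj: "inj_on y (S j)" for j
  proof (rule inj_onI, rule ccontr)
    have *: False if "B \<in> S j" "C \<in> S j" "y B = y C" "r B < l C" for B C
      using earlier[of "(B, False)" "(C, True)" j] that by (auto simp: S_def pos_def Ev_def)
    fix B C assume BC: "B \<in> S j" "C \<in> S j" "y B = y C" "B \<noteq> C"
    then have in_B: "B \<in> \<B>" "C \<in> \<B>" by (auto simp: S_def)
    then have "B \<inter> C = {}" using disj BC by blast
    have "r B < l C \<or> r C < l B"
    proof (rule ccontr)
      assume "\<not> (r B < l C \<or> r C < l B)"
      then have "(max (l B) (l C), y B) \<in> {l B..r B} \<times> {y B} \<inter> {l C..r C} \<times> {y C}"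
        using lry(1)[of B] lry(1)[of C] in_B BC by auto
      then show False using \<open>B \<inter> C = {}\<close> lry(2)[of B] lry(2)[of C] in_B by blast
    qed
    then show False using *[of B C] *[of C B] BC by auto
  qed
  have bound: "2 * card (\<Union>i\<le>M. bicoloured y c (S i)) + 5 \<le> 2 * M"
  proof (rule card_Union_bicoloured_le)
    show "S 0 = {}" by (simp add: S_def)
    show "S M = {}" using es(2) by (auto simp: S_def M_def Ev_def)
    show "3 \<le> M" using M2 two by simp
    show "finite (S i)" for i using fin by (simp add: S_def)
  qed (use inj step in auto)
  have finU: "finite (\<Union>i\<le>M. bicoloured y c (S i))"
  proof (intro finite_UN_I)
    fix i show "finite (bicoloured y c (S i))" by (rule finite_subset[OF bicoloured_subset]) (use fin in \<open>simp add: S_def\<close>)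
  qed simp
  have vis: "(B, C) \<in> (\<Union>i\<le>M. bicoloured y c (S i))" if BC: "B \<in> \<B>" "C \<in> \<B>" "channel \<B> B C" "c B \<noteq> c C" for B C
  proof -
    obtain a b where ab: "a < b" "l B \<le> a" "b \<le> r B" "l C \<le> a" "b \<le> r C" "y B < y C"
      "\<And>D x z. D \<in> \<B> \<Longrightarrow> D \<noteq> B \<Longrightarrow> D \<noteq> C \<Longrightarrow> a < x \<Longrightarrow> x < b \<Longrightarrow> y B < z \<Longrightarrow> z < y C \<Longrightarrow> (x, z) \<notin> D"
      using channelE[OF BC(3) lry(2)[OF BC(1)] lry(2)[OF BC(2)]] by blast
    \<comment> \<open>A position inside the channel: no bar over \<open>x\<close> lies strictly
      between \<open>B\<close> and \<open>C\<close>, so these are consecutive once all events up to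
      \<open>x\<close> have happened.\<close>
    define x where "x = (a + b) / 2"
    have x: "a < x" "x < b" using ab(1) by (auto simp: x_def)
    define j where "j = length (takeWhile (\<lambda>e. pos e \<le> x) es)"
    have "j \<le> M" by (simp add: j_def M_def length_takeWhile_le)
    have "sorted (map pos es)"
      unfolding sorted_map by (rule sorted_wrt_mono_rel[OF _ es(3)]) auto
    then have "set (takeWhile (\<lambda>e. pos e \<le> x) es) = {e \<in> set es. pos e \<le> x}"
      by (induction es) auto
    then have tk: "set (take j es) = {e \<in> Ev. pos e \<le> x}"
      unfolding j_def takeWhile_eq_take[symmetric] es(2) .
    have Sj: "S j = {D \<in> \<B>. l D \<le> x \<and> x < r D}"
      unfolding S_def tk by (auto simp: Ev_def pos_def)
    have "consec y (S j) B C"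
      unfolding consec_def
    proof (intro conjI ballI notI)
      show "B \<in> S j" "C \<in> S j" "y B < y C" using ab x BC by (auto simp: Sj)
      fix D assume D: "D \<in> S j" "y B < y D \<and> y D < y C"
      then have "(x, y D) \<notin> D" using ab(7)[of D x "y D"] x by (auto simp: Sj)
      moreover have "(x, y D) \<in> {l D..r D} \<times> {y D}" using D by (auto simp: Sj)
      moreover have "D \<in> \<B>" using D by (simp add: Sj)
      ultimately show False using lry(2)[of D] by blast
    qed
    then show ?thesis using BC(4) \<open>j \<le> M\<close> by (auto simp: bicoloured_def)
  qed
  \<comment> \<open>Pairs in \<open>F\<close> are ordered by colour, consecutive pairs by height.
    Reversing loses nothing, as the colours keep \<open>(B, C)\<close> and \<open>(C, B)\<close>
    from both lying in \<open>F\<close>.\<close>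
  define \<phi> where "\<phi> = (\<lambda>(B, C). if channel \<B> B C then (B, C) else (C, B))"
  have asym: "(C, B) \<notin> F" if "(B, C) \<in> F" for B C using that F by blast
  have "inj_on \<phi> F"
  proof (rule inj_onI)
    fix e e' assume *: "e \<in> F" "e' \<in> F" "\<phi> e = \<phi> e'"
    obtain B C B' C' where e: "e = (B, C)" "e' = (B', C')" by (meson surj_pair)
    then have "e = e' \<or> (B' = C \<and> C' = B)" using *(3) by (simp add: \<phi>_def split: if_splits)
    then show "e = e'" using asym[of B C] *(1,2) e by auto
  qed
  moreover have "\<phi> ` F \<subseteq> (\<Union>i\<le>M. bicoloured y c (S i))"
  proof (intro image_subsetI)
    fix e assume e: "e \<in> F"
    obtain B C where BC: "e = (B, C)" by fastforce
    with e F have "B \<in> \<B>" "C \<in> \<B>" "c B" "\<not> c C" "sees \<B> B C" by auto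
    then show "\<phi> e \<in> (\<Union>i\<le>M. bicoloured y c (S i))"
      using vis[of B C] vis[of C B] unfolding sees_def BC \<phi>_def by auto
  qed
  ultimately have "card F \<le> card (\<Union>i\<le>M. bicoloured y c (S i))"
    using card_inj_on_le finU by blast
  with bound M2 show ?thesis by simp
qed

text \<open>Bars are nonempty and disjoint even across vertices, so a bar determines its vertex.
  Choosing two bars that see each other for every edge therefore gives as many visible bicoloured
  pairs as there are edges between \<open>U\<close> and \<open>V\<close>.\<close>

lemma rep_lower_bound:
  fixes G :: "('a, 'b) pre_digraph"
  assumes rep: "bar_visibility_rep t G f"
    and V: "verts G = U \<union> V" "U \<inter> V = {}" "finite U" "finite V" "U \<noteq> {}" "V \<noteq> {}"
    and E: "\<And>u v. u \<in> U \<Longrightarrow> v \<in> V \<Longrightarrow> u \<rightarrow>\<^bsub>G\<^esub> v"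
  shows "card U * card V + 3 \<le> 2 * (t * (card U + card V))"
proof -
  let ?B = "\<Union>w \<in> verts G. f w"
  have f: "\<And>v. v \<in> verts G \<Longrightarrow> finite (f v)" "\<And>v. v \<in> verts G \<Longrightarrow> card (f v) \<le> t"
    "\<And>v B. v \<in> verts G \<Longrightarrow> B \<in> f v \<Longrightarrow> bar B"
    using rep by (auto simp: bar_visibility_rep_def)
  have disj: "B \<inter> C = {}" if "u \<in> verts G" "v \<in> verts G" "B \<in> f u" "C \<in> f v" "(u, B) \<noteq> (v, C)" for u v B C
    using rep that unfolding bar_visibility_rep_def by blast
  have nonempty: "B \<noteq> {}" if "v \<in> verts G" "B \<in> f v" for v B
    using f(3)[OF that] by (auto simp: bar_def)
  have uniq: "u = v" if "u \<in> verts G" "v \<in> verts G" "B \<in> f u" "B \<in> f v" for u v B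
    using disj[of u v B B] that nonempty[of u B] by auto
  have see: "\<exists>B C. B \<in> f u \<and> C \<in> f v \<and> sees ?B B C" if "u \<in> U" "v \<in> V" for u v
  proof -
    have "u \<noteq> v" "u \<in> verts G" "v \<in> verts G" using that V by auto
    then show ?thesis using rep E[OF that] unfolding bar_visibility_rep_def by blast
  qed
  then obtain bl br where b: "\<And>u v. u \<in> U \<Longrightarrow> v \<in> V \<Longrightarrow> bl u v \<in> f u \<and> br u v \<in> f v \<and> sees ?B (bl u v) (br u v)"
    by metis
  define c where "c B \<longleftrightarrow> (\<exists>u \<in> U. B \<in> f u)" for B
  define g where "g = (\<lambda>(u, v). (bl u v, br u v))"
  have notc: "\<not> c B" if "B \<in> f v" "v \<in> V" for B v
    using uniq[of _ v B] that V by (auto simp: c_def)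
  have "inj_on g (U \<times> V)"
  proof (rule inj_onI)
    fix e e' assume *: "e \<in> U \<times> V" "e' \<in> U \<times> V" "g e = g e'"
    obtain u v u' v' where uv: "e = (u, v)" "e' = (u', v')" by fastforce
    with * have "bl u v = bl u' v'" "br u v = br u' v'" by (auto simp: g_def)
    then have "bl u v \<in> f u'" "br u v \<in> f v'" using b[of u' v'] uv * by auto
    then show "e = e'" using uniq[of u u' "bl u v"] uniq[of v v' "br u v"] b[of u v] uv * V by auto
  qed
  then have card_g: "card (g ` (U \<times> V)) = card U * card V"
    by (simp add: card_image card_cartesian_product)
  have fin: "finite ?B" using f V by auto
  obtain u0 v0 where uv0: "u0 \<in> U" "v0 \<in> V" using V by blast
  have "bl u0 v0 \<noteq> br u0 v0" using notc[of "br u0 v0" v0] b[OF uv0] uv0 by (auto simp: c_def)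
  then have "2 = card {bl u0 v0, br u0 v0}" by simp
  also have "\<dots> \<le> card ?B" using b[OF uv0] uv0 V fin by (intro card_mono) auto
  finally have "2 \<le> card ?B" .
  then have "card (g ` (U \<times> V)) + 3 \<le> 2 * card ?B"
  proof (rule card_visible_pairs_le[OF fin, where c = c, rotated 2])
    show "bar B" if "B \<in> ?B" for B using that f by blast
    show "B \<inter> C = {}" if "B \<in> ?B" "C \<in> ?B" "B \<noteq> C" for B C
      using that disj by blast
    show "g ` (U \<times> V) \<subseteq> {(B, C). B \<in> ?B \<and> C \<in> ?B \<and> c B \<and> \<not> c C \<and> sees ?B B C}"
    proof (intro image_subsetI)
      fix e assume "e \<in> U \<times> V"
      then obtain u v where uv: "e = (u, v)" "u \<in> U" "v \<in> V" by auto
      then have "bl u v \<in> f u" "br u v \<in> f v" "sees ?B (bl u v) (br u v)" using b by auto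
      moreover have "c (bl u v)" "\<not> c (br u v)" using notc uv calculation by (auto simp: c_def)
      ultimately show "g e \<in> {(B, C). B \<in> ?B \<and> C \<in> ?B \<and> c B \<and> \<not> c C \<and> sees ?B B C}"
        using uv V by (auto simp: g_def)
    qed
  qed
  moreover have "card ?B \<le> (\<Sum>w\<in>verts G. card (f w))"
    using V by (intro card_UN_le) auto
  moreover have "\<dots> \<le> (\<Sum>w\<in>verts G. t)" by (intro sum_mono f)
  moreover have "\<dots> = t * (card U + card V)" using V by (simp add: card_Un_disjoint mult.commute)
  ultimately show ?thesis using card_g by linarith
qed

section \<open>From layouts to representations\<close>

lemma sorted_consecutive:
  fixes c :: "nat list"
  assumes "sorted_wrt (<) c" "u \<in> set c" "v \<in> set c" "u < v" "\<And>w. w \<in> set c \<Longrightarrow> \<not> (u < w \<and> w < v)"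
  shows "\<exists>xs ys. c = xs @ [u, v] @ ys"
proof -
  obtain xs zs where c: "c = xs @ u # zs" using split_list[OF assms(2)] by blast
  have "v \<in> set zs" using assms(1,3,4) by (force simp: c sorted_wrt_append)
  then obtain w ws where zs: "zs = w # ws" by (cases zs) auto
  have "u < w" using assms(1) by (simp add: c zs sorted_wrt_append)
  moreover have "w \<le> v" using assms(1) \<open>v \<in> set zs\<close> by (auto simp: c zs sorted_wrt_append)
  moreover have "\<not> w < v" using assms(5)[of w] \<open>u < w\<close> by (simp add: c zs)
  ultimately have "w = v" by simp
  then show ?thesis using c zs by auto
qed

lemma sorted_not_between:
  fixes u v w :: nat
  assumes "sorted_wrt (<) (xs @ [u, v] @ ys)" "w \<in> set (xs @ [u, v] @ ys)"
  shows "\<not> (u < w \<and> w < v)" and "u < v"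
proof -
  show "\<not> (u < w \<and> w < v)"
  proof
    assume "u < w \<and> w < v"
    moreover from this have "w \<in> set xs \<or> w \<in> set ys" using assms(2) by auto
    ultimately show False using assms(1) by (fastforce simp: sorted_wrt_append)
  qed
  show "u < v" using assms(1) by (simp add: sorted_wrt_append)
qed

text \<open>
  A layout lists, for every unit interval \<open>[i, i + 1]\<close>, the heights of the bars over it from bottom to top;
  the bar at height \<open>v\<close> belongs to the vertex \<open>hl ! v\<close>.
\<close>

lemma layout_rep:
  fixes G :: "('a, 'b) pre_digraph" and hl :: "'a list" and cols :: "nat list list"
  assumes sorted: "\<And>c. c \<in> set cols \<Longrightarrow> sorted_wrt (<) c"
    and bound: "\<And>c v. c \<in> set cols \<Longrightarrow> v \<in> set c \<Longrightarrow> v < length hl"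
    and ex: "\<And>v. v < length hl \<Longrightarrow> \<exists>c \<in> set cols. v \<in> set c"
    and contig: "\<And>v i j k. i \<le> j \<Longrightarrow> j \<le> k \<Longrightarrow> k < length cols \<Longrightarrow> v \<in> set (cols ! i) \<Longrightarrow> v \<in> set (cols ! k) \<Longrightarrow> v \<in> set (cols ! j)"
    and edge: "\<And>xs u v ys. xs @ [u, v] @ ys \<in> set cols \<Longrightarrow> hl ! u \<rightarrow>\<^bsub>G\<^esub> hl ! v \<and> hl ! v \<rightarrow>\<^bsub>G\<^esub> hl ! u"
    and all: "\<And>x y. x \<rightarrow>\<^bsub>G\<^esub> y \<Longrightarrow> \<exists>xs u v ys. xs @ [u, v] @ ys \<in> set cols \<and> (hl ! u = x \<and> hl ! v = y \<or> hl ! u = y \<and> hl ! v = x)"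
    and cnt: "\<And>w. w \<in> verts G \<Longrightarrow> card {i. i < length hl \<and> hl ! i = w} \<le> t"
    and lab: "set hl \<subseteq> verts G"
  shows "\<exists>f. bar_visibility_rep t G f"
proof -
  define I where "I v = {i. i < length cols \<and> v \<in> set (cols ! i)}" for v
  define F where "F v = Min (I v)" for v
  define L where "L v = Max (I v)" for v
  \<comment> \<open>Column \<open>i\<close> stands over \<open>[i, i + 1]\<close>, hence the
    \<open>+ 1\<close> at the right end. The height is the index \<open>v\<close> itself, so
    distinct bars are disjoint.\<close>
  define B where "B v = {real (F v)..real (L v) + 1} \<times> {real v}" for v
  define f where "f w = B ` {i. i < length hl \<and> hl ! i = w}" for w
  have fin: "finite (I v)" for v by (simp add: I_def)
  have Ine: "I v \<noteq> {}" if v: "v < length hl" for v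
  proof -
    obtain c where "c \<in> set cols" "v \<in> set c" using ex[OF v] ..
    then show ?thesis by (auto simp: I_def in_set_conv_nth[of c])
  qed
  have mem: "v \<in> set (cols ! i) \<longleftrightarrow> F v \<le> i \<and> i \<le> L v" if "v < length hl" "i < length cols" for v i
  proof
    assume "v \<in> set (cols ! i)"
    then have "i \<in> I v" using that by (simp add: I_def)
    then show "F v \<le> i \<and> i \<le> L v" using fin by (simp add: F_def L_def)
  next
    assume *: "F v \<le> i \<and> i \<le> L v"
    have "F v \<in> I v" "L v \<in> I v" using Min_in[OF fin Ine[OF that(1)]] Max_in[OF fin Ine[OF that(1)]] by (auto simp: F_def L_def)
    then show "v \<in> set (cols ! i)" using contig[of "F v" i "L v" v] * by (auto simp: I_def)
  qed
  have FL: "F v \<le> L v" "L v < length cols" if "v < length hl" for v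
  proof -
    have "F v \<in> I v" "L v \<in> I v" using Min_in[OF fin Ine[OF that(1)]] Max_in[OF fin Ine[OF that(1)]] by (auto simp: F_def L_def)
    then show "F v \<le> L v" "L v < length cols" using fin by (auto simp: F_def I_def)
  qed
  have inj: "u = v" if "B u = B v" "u < length hl" for u v
  proof -
    have "(real (F u), real u) \<in> B u" using FL[OF that(2)] by (simp add: B_def)
    then have "(real (F u), real u) \<in> B v" using that by simp
    then show "u = v" by (simp add: B_def)
  qed
  let ?B = "\<Union>w \<in> verts G. f w"
  have Bset: "?B = B ` {..<length hl}" using lab by (force simp: f_def)
  have channel_iff: "channel ?B (B u) (B v) \<longleftrightarrow> (\<exists>xs ys. xs @ [u, v] @ ys \<in> set cols)"
    if uv: "u < length hl" "v < length hl" for u v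
  proof
    assume "channel ?B (B u) (B v)"
    then obtain a b where ab: "a < b" "real (F u) \<le> a" "b \<le> real (L u) + 1" "real (F v) \<le> a" "b \<le> real (L v) + 1" "real u < real v"
      and free: "\<And>D x y. D \<in> ?B \<Longrightarrow> D \<noteq> B u \<Longrightarrow> D \<noteq> B v \<Longrightarrow> a < x \<Longrightarrow> x < b \<Longrightarrow> real u < y \<Longrightarrow> y < real v \<Longrightarrow> (x, y) \<notin> D"
      using B_def by (elim channelE) blast+
    \<comment> \<open>The bars end at integers, so both cover the whole unit interval that contains
      the left end of the channel, and both occur in column \<open>i\<close>.\<close>
    define i where "i = nat \<lfloor>a\<rfloor>"
    have "0 \<le> a" using ab(2) by (meson of_nat_0_le_iff order_trans)
    then have i: "real i \<le> a" "a < real i + 1" by (auto simp: i_def)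
    have iu: "F u \<le> i" "i \<le> L u" "F v \<le> i" "i \<le> L v" using ab i by linarith+
    then have il: "i < length cols" using FL[OF uv(1)] by simp
    have c: "cols ! i \<in> set cols" using il by simp
    have "u \<in> set (cols ! i)" "v \<in> set (cols ! i)" using mem[OF uv(1) il] mem[OF uv(2) il] iu by auto
    moreover have "\<not> (u < w \<and> w < v)" if w: "w \<in> set (cols ! i)" for w
    proof
      assume uwv: "u < w \<and> w < v"
      have wl: "w < length hl" using bound[OF c w] .
      then have "F w \<le> i" "i \<le> L w" using mem[OF wl il] w by auto
      moreover obtain x where x: "a < x" "x < b" "x < real i + 1"
        using dense[of a "min b (real i + 1)"] ab(1) i by auto
      ultimately have "(x, real w) \<in> B w" using i by (auto simp: B_def)
      moreover have "B w \<in> ?B" using wl by (auto simp: Bset)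
      moreover have "B w \<noteq> B u" "B w \<noteq> B v" using inj[of w] wl uwv by auto
      ultimately show False using free[of "B w" x "real w"] x uwv by auto
    qed
    ultimately obtain xs ys where "cols ! i = xs @ [u, v] @ ys"
      using sorted_consecutive[OF sorted[OF c], of u v] ab(6) by auto
    then show "\<exists>xs ys. xs @ [u, v] @ ys \<in> set cols" using c by metis
  next
    assume "\<exists>xs ys. xs @ [u, v] @ ys \<in> set cols"
    then obtain xs ys where "xs @ [u, v] @ ys \<in> set cols" by blast
    then obtain i where i: "i < length cols" "cols ! i = xs @ [u, v] @ ys" by (auto simp: in_set_conv_nth)
    then have c: "cols ! i \<in> set cols" using nth_mem by blast
    have "u < v" using sorted_not_between(2)[of xs u v ys u] sorted[OF c] i by simp
    have iuv: "F u \<le> i" "i \<le> L u" "F v \<le> i" "i \<le> L v" using mem[OF uv(1) i(1)] mem[OF uv(2) i(1)] i by auto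
    show "channel ?B (B u) (B v)"
      unfolding channel_def
    proof (intro exI conjI ballI)
      show "real i < real i + 1" "real u < real v" using \<open>u < v\<close> by auto
      show "{real i..real i + 1} \<times> {real u} \<subseteq> B u" "{real i..real i + 1} \<times> {real v} \<subseteq> B v"
        using iuv by (auto simp: B_def)
      fix D assume "D \<in> ?B - {B u, B v}"
      then obtain w where w: "w < length hl" "D = B w" by (auto simp: Bset)
      show "D \<inter> {real i<..<real i + 1} \<times> {real u<..<real v} = {}"
      proof (rule ccontr)
        assume "D \<inter> {real i<..<real i + 1} \<times> {real u<..<real v} \<noteq> {}"
        then obtain x where x: "real i < x" "x < real i + 1" "real (F w) \<le> x" "x \<le> real (L w) + 1" "u < w" "w < v"
          by (auto simp: w B_def)
        then have "F w \<le> i" "i \<le> L w" by linarith+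
        then have "w \<in> set (cols ! i)" using mem[OF w(1) i(1)] by simp
        then show False using sorted_not_between(1)[of xs u v ys w] sorted[OF c] i x by auto
      qed
    qed
  qed
  have "bar_visibility_rep t G f"
    unfolding bar_visibility_rep_def
  proof (intro conjI ballI impI)
    fix w assume w: "w \<in> verts G"
    show "finite (f w)" by (simp add: f_def)
    show "card (f w) \<le> t" using card_image_le[of "{i. i < length hl \<and> hl ! i = w}" B] cnt[OF w] by (simp add: f_def)
    show "bar C" if C: "C \<in> f w" for C
    proof -
      obtain v where "v < length hl" "C = B v" using C by (auto simp: f_def)
      then show "bar C" using FL[of v] unfolding bar_def B_def
        by (intro exI[of _ "real (F v)"] exI[of _ "real (L v) + 1"] exI[of _ "real v"]) auto
    qed
  next
    fix x y C D assume "C \<in> f x" "D \<in> f y" "(x, C) \<noteq> (y, D)"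
    then obtain u v where "C = B u" "D = B v" "u \<noteq> v" by (auto simp: f_def)
    then show "C \<inter> D = {}" by (auto simp: B_def)
  next
    fix x y assume xy: "x \<in> verts G" "y \<in> verts G" "x \<noteq> y"
    have "(\<exists>C\<in>f x. \<exists>D\<in>f y. sees ?B C D) \<longleftrightarrow>
      (\<exists>u v. u < length hl \<and> v < length hl \<and> hl ! u = x \<and> hl ! v = y \<and> (channel ?B (B u) (B v) \<or> channel ?B (B v) (B u)))"
      unfolding f_def sees_def by blast
    also have "\<dots> \<longleftrightarrow> (\<exists>u v. hl ! u = x \<and> hl ! v = y \<and> ((\<exists>xs ys. xs @ [u, v] @ ys \<in> set cols) \<or> (\<exists>xs ys. xs @ [v, u] @ ys \<in> set cols)))"
      (is "?l \<longleftrightarrow> ?r")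
    proof
      assume ?l then show ?r using channel_iff by metis
    next
      assume ?r
      then obtain u v where uv: "hl ! u = x" "hl ! v = y" "(\<exists>xs ys. xs @ [u, v] @ ys \<in> set cols) \<or> (\<exists>xs ys. xs @ [v, u] @ ys \<in> set cols)"
        by blast
      have "u < length hl" "v < length hl" using uv(3) bound[of _ u] bound[of _ v] by force+
      then show ?l using uv channel_iff by metis
    qed
    also have "\<dots> \<longleftrightarrow> x \<rightarrow>\<^bsub>G\<^esub> y"
      using edge all[of x y] by metis
    finally show "x \<rightarrow>\<^bsub>G\<^esub> y \<longleftrightarrow> (\<exists>C\<in>f x. \<exists>D\<in>f y. sees ?B C D)" by simp
  qed
  then show ?thesis by blast
qed

section \<open>Dissections of a disk\<close>

text \<open>
  A dissection of a disk beyond a chord with end points \<open>x\<close> and \<open>y\<close> into polygons: \<open>Side\<close> is a side of the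
  disk, \<open>Polygon j t\<close> starts a new polygon \<open>j\<close> at the chord, and \<open>Corner z s t\<close> adds the corner \<open>z\<close> to the
  current polygon, replacing the chord \<open>xy\<close> by the chords \<open>xz\<close> and \<open>zy\<close>. Gluing the disk to its mirror image along
  the boundary circle gives a planar quadrangulation, in which polygon \<open>j\<close> becomes two
  vertices \<open>Lo j\<close> and \<open>Hi j\<close>, both adjacent to every corner of \<open>j\<close>.
\<close>

datatype ('c, 'p) dis = Side | Corner 'c "('c, 'p) dis" "('c, 'p) dis" | Polygon 'p "('c, 'p) dis"

text \<open>\<open>e\<close> is the polygon on the near side of the chord, which receives the new
  corners; its incidences with the ends \<open>x\<close> and \<open>y\<close> of the chord are
  recorded further up in the tree.\<close>

fun cells :: "'p \<Rightarrow> 'c \<Rightarrow> 'c \<Rightarrow> ('c, 'p) dis \<Rightarrow> ('c \<times> 'p) set" where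
  "cells e x y Side = {}"
| "cells e x y (Corner z s t) = {(z, e)} \<union> cells e x z s \<union> cells e z y t"
| "cells e x y (Polygon j t) = {(x, j), (y, j)} \<union> cells j x y t"

fun corners :: "('c, 'p) dis \<Rightarrow> 'c multiset" where
  "corners Side = {#}"
| "corners (Corner z s t) = add_mset z (corners s + corners t)"
| "corners (Polygon j t) = corners t"

fun polygons :: "('c, 'p) dis \<Rightarrow> 'p multiset" where
  "polygons Side = {#}"
| "polygons (Corner z s t) = polygons s + polygons t"
| "polygons (Polygon j t) = add_mset j (polygons t)"

section \<open>Bars over consecutive columns\<close>

definition initial_run :: "'b \<Rightarrow> 'b list list \<Rightarrow> bool" where
  "initial_run v cs \<longleftrightarrow> (\<exists>xs ys. cs = xs @ ys \<and> (\<forall>c\<in>set xs. v \<in> set c) \<and> (\<forall>c\<in>set ys. v \<notin> set c))"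

definition final_run :: "'b \<Rightarrow> 'b list list \<Rightarrow> bool" where
  "final_run v cs \<longleftrightarrow> (\<exists>xs ys. cs = xs @ ys \<and> (\<forall>c\<in>set xs. v \<notin> set c) \<and> (\<forall>c\<in>set ys. v \<in> set c))"

text \<open>Contiguity in the form in which it arises when blocks of columns are concatenated: a run
  that reaches the end of the first block is continued from the start of the second. Either half may
  be empty.\<close>

definition one_run :: "'b \<Rightarrow> 'b list list \<Rightarrow> bool" where
  "one_run v cs \<longleftrightarrow> (\<exists>xs ys. cs = xs @ ys \<and> final_run v xs \<and> initial_run v ys)"

lemma initial_run_intros:
  "(\<forall>c\<in>set cs. v \<in> set c) \<Longrightarrow> initial_run v cs"
  "(\<forall>c\<in>set cs. v \<notin> set c) \<Longrightarrow> initial_run v cs"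
  "(\<forall>c\<in>set xs. v \<in> set c) \<Longrightarrow> initial_run v ys \<Longrightarrow> initial_run v (xs @ ys)"
  "initial_run v xs \<Longrightarrow> (\<forall>c\<in>set ys. v \<notin> set c) \<Longrightarrow> initial_run v (xs @ ys)"
proof -
  show "(\<forall>c\<in>set cs. v \<in> set c) \<Longrightarrow> initial_run v cs"
    unfolding initial_run_def by (rule exI[of _ cs], rule exI[of _ "[]"]) simp
  show "(\<forall>c\<in>set cs. v \<notin> set c) \<Longrightarrow> initial_run v cs"
    unfolding initial_run_def by (rule exI[of _ "[]"], rule exI[of _ cs]) simp
  show "initial_run v (xs @ ys)" if *: "\<forall>c\<in>set xs. v \<in> set c" "initial_run v ys"
  proof -
    obtain as bs where "ys = as @ bs" "\<forall>c\<in>set as. v \<in> set c" "\<forall>c\<in>set bs. v \<notin> set c"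
      using *(2) unfolding initial_run_def by blast
    then show ?thesis unfolding initial_run_def using *(1)
      by (intro exI[of _ "xs @ as"] exI[of _ bs]) auto
  qed
  show "initial_run v (xs @ ys)" if *: "initial_run v xs" "\<forall>c\<in>set ys. v \<notin> set c"
  proof -
    obtain as bs where "xs = as @ bs" "\<forall>c\<in>set as. v \<in> set c" "\<forall>c\<in>set bs. v \<notin> set c"
      using *(1) unfolding initial_run_def by blast
    then show ?thesis unfolding initial_run_def using *(2)
      by (intro exI[of _ as] exI[of _ "bs @ ys"]) auto
  qed
qed

lemma initial_run_rev: "initial_run v (rev cs) \<longleftrightarrow> final_run v cs"
proof
  assume "initial_run v (rev cs)"
  then obtain as bs where "rev cs = as @ bs" "\<forall>c\<in>set as. v \<in> set c" "\<forall>c\<in>set bs. v \<notin> set c"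
    unfolding initial_run_def by blast
  then have "cs = rev bs @ rev as" by (metis rev_append rev_rev_ident)
  with \<open>\<forall>c\<in>set as. v \<in> set c\<close> \<open>\<forall>c\<in>set bs. v \<notin> set c\<close> show "final_run v cs"
    unfolding final_run_def by (intro exI[of _ "rev bs"] exI[of _ "rev as"]) auto
next
  assume "final_run v cs"
  then obtain as bs where "cs = as @ bs" "\<forall>c\<in>set as. v \<notin> set c" "\<forall>c\<in>set bs. v \<in> set c"
    unfolding final_run_def by blast
  then show "initial_run v (rev cs)"
    unfolding initial_run_def by (intro exI[of _ "rev bs"] exI[of _ "rev as"]) auto
qed

lemma final_run_intros:
  "(\<forall>c\<in>set cs. v \<in> set c) \<Longrightarrow> final_run v cs"
  "(\<forall>c\<in>set cs. v \<notin> set c) \<Longrightarrow> final_run v cs"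
  "(\<forall>c\<in>set xs. v \<notin> set c) \<Longrightarrow> final_run v ys \<Longrightarrow> final_run v (xs @ ys)"
  "final_run v xs \<Longrightarrow> (\<forall>c\<in>set ys. v \<in> set c) \<Longrightarrow> final_run v (xs @ ys)"
  by (simp_all add: initial_run_rev[symmetric] initial_run_intros)

lemma one_run_intros:
  "initial_run v cs \<Longrightarrow> one_run v cs"
  "final_run v cs \<Longrightarrow> one_run v cs"
  "final_run v xs \<Longrightarrow> initial_run v ys \<Longrightarrow> one_run v (xs @ ys)"
  "(\<forall>c\<in>set xs. v \<notin> set c) \<Longrightarrow> one_run v ys \<Longrightarrow> one_run v (xs @ ys)"
  "one_run v xs \<Longrightarrow> (\<forall>c\<in>set ys. v \<notin> set c) \<Longrightarrow> one_run v (xs @ ys)"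
proof -
  show "initial_run v cs \<Longrightarrow> one_run v cs"
    unfolding one_run_def by (rule exI[of _ "[]"], rule exI[of _ cs]) (simp add: final_run_intros)
  show "final_run v cs \<Longrightarrow> one_run v cs"
    unfolding one_run_def by (rule exI[of _ cs], rule exI[of _ "[]"]) (simp add: initial_run_intros)
  show "final_run v xs \<Longrightarrow> initial_run v ys \<Longrightarrow> one_run v (xs @ ys)"
    unfolding one_run_def by blast
  show "one_run v (xs @ ys)" if *: "\<forall>c\<in>set xs. v \<notin> set c" "one_run v ys"
  proof -
    obtain as bs where "ys = as @ bs" "final_run v as" "initial_run v bs" using *(2) unfolding one_run_def by blast
    then show ?thesis unfolding one_run_def using final_run_intros(3)[OF *(1)]
      by (intro exI[of _ "xs @ as"] exI[of _ bs]) auto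
  qed
  show "one_run v (xs @ ys)" if *: "one_run v xs" "\<forall>c\<in>set ys. v \<notin> set c"
  proof -
    obtain as bs where "xs = as @ bs" "final_run v as" "initial_run v bs" using *(1) unfolding one_run_def by blast
    then show ?thesis unfolding one_run_def using initial_run_intros(4)[OF _ *(2)]
      by (intro exI[of _ as] exI[of _ "bs @ ys"]) auto
  qed
qed

lemma one_run_map:
  assumes iff: "\<And>c. v \<in> set (g c) \<longleftrightarrow> v \<in> set c" and "one_run v cs"
  shows "one_run v (map g cs)"
proof -
  have initial_run: "initial_run v (map g xs)" if xs: "initial_run v xs" for xs
  proof -
    obtain as bs where "xs = as @ bs" "\<forall>c\<in>set as. v \<in> set c" "\<forall>c\<in>set bs. v \<notin> set c"
      using xs unfolding initial_run_def by blast
    then show ?thesis unfolding initial_run_def by (intro exI[of _ "map g as"] exI[of _ "map g bs"]) (simp add: iff)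
  qed
  have final_run: "final_run v (map g xs)" if "final_run v xs" for xs
    using initial_run[of "rev xs"] that by (simp add: initial_run_rev rev_map[symmetric])
  obtain xs ys where "cs = xs @ ys" "final_run v xs" "initial_run v ys" using assms(2) unfolding one_run_def by blast
  then show ?thesis using initial_run final_run by (simp add: one_run_intros(3))
qed

lemma one_run_nth:
  assumes "one_run v cs" "i \<le> j" "j \<le> k" "k < length cs" "v \<in> set (cs ! i)" "v \<in> set (cs ! k)"
  shows "v \<in> set (cs ! j)"
proof -
  obtain xs ys where cs: "cs = xs @ ys" and "final_run v xs" "initial_run v ys" using assms(1) unfolding one_run_def by blast
  then obtain as bs ds es where xs: "xs = as @ bs" "\<forall>c\<in>set as. v \<notin> set c" "\<forall>c\<in>set bs. v \<in> set c"
    and ys: "ys = ds @ es" "\<forall>c\<in>set ds. v \<in> set c" "\<forall>c\<in>set es. v \<notin> set c"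
    unfolding final_run_def initial_run_def by blast
  let ?m = "bs @ ds"
  have cs': "cs = as @ ?m @ es" using cs xs ys by simp
  have m: "\<forall>c\<in>set ?m. v \<in> set c" using xs ys by auto
  have 1: "length as \<le> i"
  proof (rule ccontr)
    assume "\<not> length as \<le> i"
    then have "cs ! i \<in> set as" by (simp add: cs' nth_append)
    then show False using assms(5) xs(2) by blast
  qed
  have 2: "k < length as + length ?m"
  proof (rule ccontr)
    assume "\<not> k < length as + length ?m"
    then have k: "k - length as - length ?m < length es" "\<not> k < length as" "\<not> k - length as < length ?m" using assms(4) by (auto simp: cs')
    then have "cs ! k = es ! (k - length as - length ?m)" by (simp only: cs' nth_append if_False)
    then have "cs ! k \<in> set es" using k(1) by simp
    then show False using assms(6) ys(3) by blast
  qed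
  have j: "\<not> j < length as" "j - length as < length ?m" using 1 2 assms by auto
  then have "cs ! j = ?m ! (j - length as)" by (simp only: cs' nth_append if_False if_True)
  then have "cs ! j \<in> set ?m" using j(2) nth_mem by metis
  then show ?thesis using m by blast
qed

section \<open>The layout of a dissection\<close>

datatype ('c, 'p) item = Cor 'c | Lo 'p | Hi 'p

fun isCor :: "('c, 'p) item \<Rightarrow> bool" where
  "isCor (Cor z) = True" | "isCor (Lo j) = False" | "isCor (Hi j) = False"

text \<open>The order of the bars from bottom to top: \<open>Lo j\<close> and \<open>Hi j\<close>
  enclose all that lies beyond their chord, and a corner separates the parts beyond the two chords
  that meet in it.\<close>

fun items :: "('c, 'p) dis \<Rightarrow> ('c, 'p) item list" where
  "items Side = []"
| "items (Corner z s t) = items s @ Cor z # items t"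
| "items (Polygon j t) = Lo j # items t @ [Hi j]"

abbreviation sz :: "('c, 'p) dis \<Rightarrow> nat" where "sz t \<equiv> length (items t)"

text \<open>
  Bars are identified with their heights, which are the positions in \<open>items\<close> shifted by the offset \<open>k\<close>. In the columns for a part of a polygon,
  \<open>l\<close> and \<open>l'\<close> are the two bars of the polygon, and \<open>pre\<close> and \<open>suf\<close> are the bars of the polygon and its corners
  that enclose the part.
\<close>

fun cols :: "nat \<Rightarrow> nat \<Rightarrow> nat list \<Rightarrow> nat list \<Rightarrow> nat \<Rightarrow> ('c, 'p) dis \<Rightarrow> nat list list" where
  "cols l l' pre suf k Side = []"
| "cols l l' pre suf k (Corner z s t) =
     (let h = k + sz s in cols l l' [l, h] suf (Suc h) t @ [[l, h, l']] @ cols l l' pre [h, l'] k s)"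
| "cols l l' pre suf k (Polygon j t) =
     (let h = Suc (k + sz t) in map (\<lambda>c. pre @ c @ suf) ([[k]] @ cols k h [] [] (Suc k) t @ [[h]]))"

definition frame :: "nat \<Rightarrow> nat \<Rightarrow> nat list \<Rightarrow> nat list \<Rightarrow> nat \<Rightarrow> nat \<Rightarrow> bool" where
  "frame l l' pre suf k n \<longleftrightarrow> l < k \<and> k + n \<le> l' \<and> (pre = [] \<or> (\<exists>z. pre = [l, z] \<and> l < z \<and> z < k)) \<and>
     (suf = [] \<or> (\<exists>z. suf = [z, l'] \<and> k + n \<le> z \<and> z < l'))"

lemma frame_Corner:
  assumes "frame l l' pre suf k (sz (Corner z s t))"
  shows "frame l l' [l, k + sz s] suf (Suc (k + sz s)) (sz t)" "frame l l' pre [k + sz s, l'] k (sz s)"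
  using assms by (auto simp: frame_def)

lemma frame_Polygon: "frame k (Suc (k + sz t)) [] [] (Suc k) (sz t)"
  by (simp add: frame_def)

lemma cols_bound:
  assumes "c \<in> set (cols l l' pre suf k t)" "v \<in> set c"
  shows "v \<in> {l, l'} \<union> set pre \<union> set suf \<union> {k..<k + sz t}"
  using assms
proof (induction t arbitrary: l l' pre suf k c)
  case (Corner z s t)
  then consider "c \<in> set (cols l l' [l, k + sz s] suf (Suc (k + sz s)) t)" | "c = [l, k + sz s, l']"
    | "c \<in> set (cols l l' pre [k + sz s, l'] k s)" by (auto simp: Let_def)
  then show ?case
  proof cases
    case 1 from Corner.IH(2)[OF this Corner.prems(2)] show ?thesis by auto
  next
    case 2 with Corner.prems(2) show ?thesis by auto
  next
    case 3 from Corner.IH(1)[OF this Corner.prems(2)] show ?thesis by auto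
  qed
next
  case (Polygon j t)
  let ?h = "Suc (k + sz t)"
  obtain d where d: "c = pre @ d @ suf" "d = [k] \<or> d = [?h] \<or> d \<in> set (cols k ?h [] [] (Suc k) t)"
    using Polygon.prems(1) by (auto simp: Let_def)
  have "v \<in> {k..<k + sz (Polygon j t)}" if "v \<in> set d"
    using d(2) that Polygon.IH[of d k ?h "[]" "[]" "Suc k"] by auto
  then show ?case using d(1) Polygon.prems(2) by auto
qed simp

lemma cols_sorted:
  assumes "frame l l' pre suf k (sz t)" "c \<in> set (cols l l' pre suf k t)"
  shows "sorted_wrt (<) c"
  using assms
proof (induction t arbitrary: l l' pre suf k c)
  case (Corner z s t)
  from Corner.prems(2) consider "c \<in> set (cols l l' [l, k + sz s] suf (Suc (k + sz s)) t)" | "c = [l, k + sz s, l']"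
    | "c \<in> set (cols l l' pre [k + sz s, l'] k s)" by (auto simp: Let_def)
  then show ?case
  proof cases
    case 1 from Corner.IH(2)[OF frame_Corner(1)[OF Corner.prems(1)] this] show ?thesis .
  next
    case 2 with Corner.prems(1) show ?thesis by (auto simp: frame_def)
  next
    case 3 from Corner.IH(1)[OF frame_Corner(2)[OF Corner.prems(1)] this] show ?thesis .
  qed
next
  case (Polygon j t)
  let ?h = "Suc (k + sz t)"
  obtain d where d: "c = pre @ d @ suf" "d = [k] \<or> d = [?h] \<or> d \<in> set (cols k ?h [] [] (Suc k) t)"
    using Polygon.prems(2) by (auto simp: Let_def)
  have "sorted_wrt (<) d" using d(2) Polygon.IH[OF frame_Polygon] by auto
  moreover have "v \<in> {k..<k + sz (Polygon j t)}" if "v \<in> set d" for v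
    using d(2) that cols_bound[of d k ?h "[]" "[]" "Suc k" t v] by auto
  ultimately show ?case
    using Polygon.prems(1) by (fastforce simp: d(1) frame_def sorted_wrt_append)
qed simp

lemma cols_cover:
  assumes "v \<in> {k..<k + sz t}"
  shows "\<exists>c\<in>set (cols l l' pre suf k t). v \<in> set c"
  using assms
proof (induction t arbitrary: l l' pre suf k)
  case (Corner z s t)
  then consider "v \<in> {k..<k + sz s}" | "v = k + sz s" | "v \<in> {Suc (k + sz s)..<Suc (k + sz s) + sz t}"
    by fastforce
  then show ?case
  proof cases
    case 1 from Corner.IH(1)[OF this] show ?thesis by (fastforce simp: Let_def)
  next
    case 2 then show ?thesis by (auto simp: Let_def)
  next
    case 3 from Corner.IH(2)[OF this] show ?thesis by (fastforce simp: Let_def)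
  qed
next
  case (Polygon j t)
  then consider "v = k" | "v = Suc (k + sz t)" | "v \<in> {Suc k..<Suc k + sz t}" by fastforce
  then show ?case
  proof cases
    case 3 from Polygon.IH[OF this, of k "Suc (k + sz t)" "[]" "[]"] show ?thesis by (auto simp: Let_def)
  qed (auto simp: Let_def)
qed simp

text \<open>Bars from outside the part cross into its columns, so the induction has to know on which
  side they do. The columns for \<open>t\<close> precede those for \<open>s\<close>: in the former
  \<open>l\<close> still lies below the new corner, in the latter \<open>l'\<close> already lies
  above it, and in the column between them the corner sees both. The corner is a final run in the
  columns for \<open>t\<close> and an initial run in those for \<open>s\<close>, which together make
  one run.\<close>

lemma cols_contiguous:
  assumes "frame l l' pre suf k (sz t)"
  shows "(pre \<noteq> [] \<longrightarrow> (\<forall>c\<in>set (cols l l' pre suf k t). l \<in> set c)) \<and> initial_run l (cols l l' pre suf k t)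
    \<and> (suf \<noteq> [] \<longrightarrow> (\<forall>c\<in>set (cols l l' pre suf k t). l' \<in> set c)) \<and> final_run l' (cols l l' pre suf k t)
    \<and> (\<forall>z. pre = [l, z] \<longrightarrow> final_run z (cols l l' pre suf k t))
    \<and> (\<forall>z. suf = [z, l'] \<longrightarrow> initial_run z (cols l l' pre suf k t))
    \<and> (\<forall>v\<in>{k..<k + sz t}. one_run v (cols l l' pre suf k t))"
  using assms
proof (induction t arbitrary: l l' pre suf k)
  case Side
  then show ?case by (auto simp: initial_run_def final_run_def)
next
  case (Corner z s t)
  let ?h = "k + sz s"
  let ?A = "cols l l' [l, ?h] suf (Suc ?h) t" and ?B = "[[l, ?h, l']]" and ?D = "cols l l' pre [?h, l'] k s"
  note fr = frame_Corner[OF Corner.prems]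
  note IHt = Corner.IH(2)[OF fr(1)] and IHs = Corner.IH(1)[OF fr(2)]
  have F: "l < k" "k + sz (Corner z s t) \<le> l'" "?h < l'"
    "\<And>w. pre = [l, w] \<Longrightarrow> l < w \<and> w < k" "\<And>w. suf = [w, l'] \<Longrightarrow> k + sz (Corner z s t) \<le> w \<and> w < l'"
    using Corner.prems by (auto simp: frame_def)
  have eq: "cols l l' pre suf k (Corner z s t) = ?A @ ?B @ ?D" by (simp add: Let_def)
  have bA: "v \<in> {l, l', ?h} \<union> set suf \<union> {Suc ?h..<Suc ?h + sz t}" if "c \<in> set ?A" "v \<in> set c" for c v
    using cols_bound[OF that] by auto
  have bD: "v \<in> {l, l', ?h} \<union> set pre \<union> {k..<?h}" if "c \<in> set ?D" "v \<in> set c" for c v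
    using cols_bound[OF that] by auto
  have pre: "pre = [] \<or> (\<exists>w. pre = [l, w])" and suf: "suf = [] \<or> (\<exists>w. suf = [w, l'])"
    using Corner.prems by (auto simp: frame_def)
  have n1: "pre \<noteq> [] \<longrightarrow> (\<forall>c\<in>set (?A @ ?B @ ?D). l \<in> set c)" using IHt IHs by auto
  have n2: "suf \<noteq> [] \<longrightarrow> (\<forall>c\<in>set (?A @ ?B @ ?D). l' \<in> set c)" using IHt IHs by auto
  have n3: "initial_run l (?A @ ?B @ ?D)"
    by (intro initial_run_intros(3)) (use IHt IHs in auto)
  have n4: "final_run l' (?A @ ?B @ ?D)"
    by (intro final_run_intros(4)) (use IHt IHs in auto)
  have n5: "final_run w (?A @ ?B @ ?D)" if w: "pre = [l, w]" for w
  proof (intro final_run_intros(3) ballI notI)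
    show "final_run w ?D" using IHs w by blast
    fix c assume c: "w \<in> set c"
    { assume "c \<in> set ?A" from bA[OF this c] show False using F(1-3) F(4)[OF w] suf F(5) by auto }
    { assume "c \<in> set ?B" then show False using c F(1-3) F(4)[OF w] by auto }
  qed
  have n6: "initial_run w (?A @ ?B @ ?D)" if w: "suf = [w, l']" for w
  proof (intro initial_run_intros(4) ballI notI)
    show "initial_run w ?A" using IHt w by blast
    fix c assume c: "w \<in> set c" "c \<in> set (?B @ ?D)"
    then consider "c = [l, ?h, l']" | "c \<in> set ?D" by auto
    then show False
    proof cases
      case 1 then show False using c F(1-3) F(5)[OF w] by auto
    next
      case 2 from bD[OF this c(1)] show False using F(1-3) F(5)[OF w] pre F(4) by auto
    qed
  qed
  have n7: "one_run v (?A @ ?B @ ?D)" if v: "v \<in> {k..<k + sz (Corner z s t)}" for v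
  proof -
    consider "v \<in> {k..<?h}" | "v = ?h" | "v \<in> {Suc ?h..<Suc ?h + sz t}" using v by fastforce
    then show ?thesis
    proof cases
      case 1
      have "\<forall>c\<in>set ?A. v \<notin> set c" "\<forall>c\<in>set ?B. v \<notin> set c"
        using bA[of _ v] 1 F suf by fastforce+
      moreover have "one_run v ?D" using IHs 1 by blast
      ultimately show ?thesis by (intro one_run_intros(4))
    next
      case 2
      have "final_run ?h ?A" using IHt by blast
      moreover have "initial_run ?h (?B @ ?D)" by (rule initial_run_intros(3)) (use IHs in auto)
      ultimately show ?thesis unfolding 2 by (rule one_run_intros(3))
    next
      case 3
      have "\<forall>c\<in>set (?B @ ?D). v \<notin> set c"
        using bD[of _ v] 3 F pre by fastforce
      moreover have "one_run v ?A" using IHt 3 by blast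
      ultimately show ?thesis by (intro one_run_intros(5))
    qed
  qed
  show ?case unfolding eq using n1 n2 n3 n4 n5 n6 n7 by blast
next
  case (Polygon j t)
  let ?h = "Suc (k + sz t)"
  let ?C = "cols k ?h [] [] (Suc k) t"
  let ?X = "[[k]] @ ?C @ [[?h]]"
  note IH = Polygon.IH[OF frame_Polygon]
  have eq: "cols l l' pre suf k (Polygon j t) = map (\<lambda>c. pre @ c @ suf) ?X" by (simp add: Let_def)
  have F: "l < k" "k + sz (Polygon j t) \<le> l'" "pre = [] \<or> (\<exists>w. pre = [l, w] \<and> l < w \<and> w < k)"
    "suf = [] \<or> (\<exists>w. suf = [w, l'] \<and> k + sz (Polygon j t) \<le> w \<and> w < l')"
    using Polygon.prems by (auto simp: frame_def)
  have b: "v \<in> {k..<k + sz (Polygon j t)}" if "c \<in> set ?X" "v \<in> set c" for c v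
    using cols_bound[of c k ?h "[]" "[]" "Suc k" t v] that by auto
  have out: "v \<in> set (pre @ c @ suf) \<longleftrightarrow> v \<in> set pre \<or> v \<in> set suf" if "c \<in> set ?X" "v < k \<or> k + sz (Polygon j t) \<le> v" for c v
    using b[OF that(1), of v] that(2) by auto
  have outer: "(\<forall>c\<in>set (map (\<lambda>c. pre @ c @ suf) ?X). v \<in> set c) \<or> (\<forall>c\<in>set (map (\<lambda>c. pre @ c @ suf) ?X). v \<notin> set c)"
    if v: "v < k \<or> k + sz (Polygon j t) \<le> v" for v
  proof (cases "v \<in> set pre \<union> set suf")
    case True
    then have "\<forall>c\<in>set (map (\<lambda>c. pre @ c @ suf) ?X). v \<in> set c" by auto
    then show ?thesis ..
  next
    case False
    have "v \<notin> set c'" if c': "c' \<in> set (map (\<lambda>c. pre @ c @ suf) ?X)" for c'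
    proof -
      obtain c where c: "c \<in> set ?X" "c' = pre @ c @ suf" using c' unfolding set_map by blast
      show ?thesis using out[OF c(1) v] False unfolding c(2) by blast
    qed
    then show ?thesis by blast
  qed
  have pfs: "initial_run v (map (\<lambda>c. pre @ c @ suf) ?X)" "final_run v (map (\<lambda>c. pre @ c @ suf) ?X)"
    if v: "v < k \<or> k + sz (Polygon j t) \<le> v" for v
  proof -
    show "initial_run v (map (\<lambda>c. pre @ c @ suf) ?X)"
      using outer[OF v] by (rule disjE) (erule initial_run_intros(1), erule initial_run_intros(2))
    show "final_run v (map (\<lambda>c. pre @ c @ suf) ?X)"
      using outer[OF v] by (rule disjE) (erule final_run_intros(1), erule final_run_intros(2))
  qed
  have ctgX: "one_run v ?X" if v: "v \<in> {k..<k + sz (Polygon j t)}" for v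
  proof -
    have bC: "w \<in> {k..?h}" if "c \<in> set ?C" "w \<in> set c" for c w
      using cols_bound[OF that] by auto
    consider "v = k" | "v = ?h" | "v \<in> {Suc k..<Suc k + sz t}" using v by fastforce
    then show ?thesis
    proof cases
      case 1
      have "initial_run k ([[k]] @ ?C @ [[?h]])"
        by (intro initial_run_intros(3,4)) (use IH in auto)
      with 1 show ?thesis by (simp only: one_run_intros(1))
    next
      case 2
      have "final_run ?h ([[k]] @ ?C @ [[?h]])"
        by (intro final_run_intros(3,4)) (use IH in auto)
      with 2 show ?thesis by (simp only: one_run_intros(2))
    next
      case 3
      have "one_run v ([[k]] @ ?C @ [[?h]])"
        by (intro one_run_intros(4,5)) (use IH 3 in auto)
      then show ?thesis .
    qed
  qed
  have one_run_cols: "one_run v (map (\<lambda>c. pre @ c @ suf) ?X)" if v: "v \<in> {k..<k + sz (Polygon j t)}" for v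
  proof -
    have "v \<notin> set pre \<union> set suf" using v F by auto
    then have iff: "v \<in> set (pre @ c @ suf) \<longleftrightarrow> v \<in> set c" for c by auto
    show ?thesis by (rule one_run_map[OF iff ctgX[OF v]])
  qed
  have l: "l < k \<or> k + sz (Polygon j t) \<le> l" "l' < k \<or> k + sz (Polygon j t) \<le> l'" using F by auto
  have z1: "final_run w (map (\<lambda>c. pre @ c @ suf) ?X)" if "pre = [l, w]" for w
    using pfs(2)[of w] that F(3) by auto
  have z2: "initial_run w (map (\<lambda>c. pre @ c @ suf) ?X)" if "suf = [w, l']" for w
    using pfs(1)[of w] that F(4) by auto
  have a1: "pre \<noteq> [] \<longrightarrow> (\<forall>c\<in>set (map (\<lambda>c. pre @ c @ suf) ?X). l \<in> set c)" using F(3) by auto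
  have a2: "suf \<noteq> [] \<longrightarrow> (\<forall>c\<in>set (map (\<lambda>c. pre @ c @ suf) ?X). l' \<in> set c)" using F(4) by auto
  show ?case unfolding eq using pfs[OF l(1)] pfs[OF l(2)] a1 a2 z1 z2 one_run_cols by blast
qed

abbreviation alt :: "(nat \<Rightarrow> ('c, 'p) item) \<Rightarrow> nat list \<Rightarrow> bool" where
  "alt lab \<equiv> successively (\<lambda>u v. isCor (lab u) \<noteq> isCor (lab v))"

text \<open>This excludes unwanted visibilities: neighbours in a column are a corner and a bar of a
  polygon. Since columns begin and end with bars of polygons, corners can be put around them without
  breaking the alternation.\<close>

lemma cols_alternating:
  assumes "\<And>i. i < sz t \<Longrightarrow> lab (k + i) = items t ! i" "lab l = Lo j" "lab l' = Hi j"
    and "pre = [] \<or> (\<exists>z. pre = [l, z] \<and> isCor (lab z))" "suf = [] \<or> (\<exists>z. suf = [z, l'] \<and> isCor (lab z))"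
    and "c \<in> set (cols l l' pre suf k t)"
  shows "c \<noteq> [] \<and> alt lab c \<and> \<not> isCor (lab (hd c)) \<and> \<not> isCor (lab (last c))"
  using assms
proof (induction t arbitrary: l l' pre suf k c j)
  case (Corner z s t)
  have lab: "lab (k + i) = (items s @ Cor z # items t) ! i" if "i < sz s + Suc (sz t)" for i
    using Corner.prems(1) that by simp
  have h: "lab (k + sz s) = Cor z" using lab[of "sz s"] by simp
  from Corner.prems(6) consider "c \<in> set (cols l l' [l, k + sz s] suf (Suc (k + sz s)) t)" | "c = [l, k + sz s, l']"
    | "c \<in> set (cols l l' pre [k + sz s, l'] k s)" by (auto simp: Let_def)
  then show ?case
  proof cases
    case 1
    show ?thesis
    proof (rule Corner.IH(2)[OF _ Corner.prems(2,3) _ Corner.prems(5) 1])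
      show "lab (Suc (k + sz s) + i) = items t ! i" if "i < sz t" for i
        using lab[of "Suc (sz s + i)"] that by (simp add: nth_append add.assoc)
    qed (use h in auto)
  next
    case 2 then show ?thesis using h Corner.prems by simp
  next
    case 3
    show ?thesis
    proof (rule Corner.IH(1)[OF _ Corner.prems(2,3,4) _ 3])
      show "lab (k + i) = items s ! i" if "i < sz s" for i
        using lab[of i] that by (simp add: nth_append)
    qed (use h in auto)
  qed
next
  case (Polygon i t)
  let ?h = "Suc (k + sz t)"
  have lab: "lab (k + n) = (Lo i # items t @ [Hi i]) ! n" if "n < Suc (Suc (sz t))" for n
    using Polygon.prems(1) that by simp
  have k: "lab k = Lo i" "lab ?h = Hi i" using lab[of 0] lab[of "Suc (sz t)"] by (auto simp: nth_append)
  obtain d where d: "c = pre @ d @ suf" "d = [k] \<or> d = [?h] \<or> d \<in> set (cols k ?h [] [] (Suc k) t)"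
    using Polygon.prems(6) by (auto simp: Let_def)
  have "d \<noteq> [] \<and> alt lab d \<and> \<not> isCor (lab (hd d)) \<and> \<not> isCor (lab (last d))"
  proof (cases "d \<in> set (cols k ?h [] [] (Suc k) t)")
    case True
    show ?thesis
    proof (rule Polygon.IH[OF _ k _ _ True])
      show "lab (Suc k + n) = items t ! n" if "n < sz t" for n
        using lab[of "Suc n"] that by (simp add: nth_append)
    qed auto
  next
    case False then show ?thesis using d(2) k by auto
  qed
  then show ?case using Polygon.prems(2-5) by (auto simp: d(1) successively_append_iff)
qed simp

section \<open>Visible pairs in the layout\<close>

definition consecutive_in :: "'b list \<Rightarrow> 'b \<Rightarrow> 'b \<Rightarrow> bool" where
  "consecutive_in c u v \<longleftrightarrow> (\<exists>xs ys. c = xs @ [u, v] @ ys)"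

lemma consecutive_in_append: "consecutive_in c u v \<Longrightarrow> consecutive_in (xs @ c @ ys) u v"
  unfolding consecutive_in_def by (metis append.assoc)

lemma consecutive_inI: "consecutive_in (xs @ u # v # ys) u v"
  unfolding consecutive_in_def by auto

definition meet :: "(nat \<Rightarrow> 'v) \<Rightarrow> nat list set \<Rightarrow> 'v \<Rightarrow> 'v \<Rightarrow> bool" where
  "meet lab cs x y \<longleftrightarrow> (\<exists>c\<in>cs. \<exists>u v. consecutive_in c u v \<and> (lab u = x \<and> lab v = y \<or> lab u = y \<and> lab v = x))"

lemma meetI:
  "c \<in> cs \<Longrightarrow> consecutive_in c u v \<Longrightarrow> lab u = x \<Longrightarrow> lab v = y \<Longrightarrow> meet lab cs x y"
  "c \<in> cs \<Longrightarrow> consecutive_in c u v \<Longrightarrow> lab u = y \<Longrightarrow> lab v = x \<Longrightarrow> meet lab cs x y"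
  unfolding meet_def by blast+

lemma meet_mono: "meet lab cs x y \<Longrightarrow> cs \<subseteq> ds \<Longrightarrow> meet lab ds x y"
  unfolding meet_def by blast

lemma meet_append:
  "meet lab cs x y \<Longrightarrow> meet lab ((\<lambda>c. xs @ c @ ys) ` cs) x y"
  unfolding meet_def by (fastforce intro: consecutive_in_append)

text \<open>\<open>hx\<close> and \<open>hy\<close> are the bars directly below and above the part of the layout built for \<open>t\<close>, when there
  is no enclosing corner inside the polygon.\<close>

lemma cols_meet:
  assumes "\<And>i. i < sz t \<Longrightarrow> lab (k + i) = items t ! i" "lab l = Lo j" "lab l' = Hi j"
    and "pre = [] \<or> length pre = 2" "lab (last (hx # pre)) = Cor x"
    and "suf = [] \<or> length suf = 2" "lab (hd (suf @ [hy])) = Cor y"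
    and "(z, i) \<in> cells j x y t"
  shows "meet lab ((\<lambda>c. hx # c @ [hy]) ` set (cols l l' pre suf k t)) (Cor z) (Lo i)"
    and "meet lab ((\<lambda>c. hx # c @ [hy]) ` set (cols l l' pre suf k t)) (Cor z) (Hi i)"
proof -
  have "meet lab ((\<lambda>c. hx # c @ [hy]) ` set (cols l l' pre suf k t)) (Cor z) (Lo i)
      \<and> meet lab ((\<lambda>c. hx # c @ [hy]) ` set (cols l l' pre suf k t)) (Cor z) (Hi i)"
    using assms
  proof (induction t arbitrary: l l' pre suf k j x y hx hy)
    case (Corner w s t)
    let ?f = "\<lambda>c. hx # c @ [hy]"
    let ?h = "k + sz s"
    have lab: "lab (k + i) = (items s @ Cor w # items t) ! i" if "i < sz s + Suc (sz t)" for i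
      using Corner.prems(1) that by simp
    have h: "lab ?h = Cor w" using lab[of "sz s"] by simp
    have eq: "set (cols l l' pre suf k (Corner w s t)) =
      set (cols l l' [l, ?h] suf (Suc ?h) t) \<union> {[l, ?h, l']} \<union> set (cols l l' pre [?h, l'] k s)" by (auto simp: Let_def)
    consider "z = w" "i = j" | "(z, i) \<in> cells j x w s" | "(z, i) \<in> cells j w y t"
      using Corner.prems(8) by auto
    then show ?case
    proof cases
      case 1
      have "?f [l, ?h, l'] \<in> ?f ` set (cols l l' pre suf k (Corner w s t))" unfolding eq by blast
      moreover have "consecutive_in (?f [l, ?h, l']) l ?h" "consecutive_in (?f [l, ?h, l']) ?h l'"
        using consecutive_inI[of "[hx]" l ?h "[l', hy]"] consecutive_inI[of "[hx, l]" ?h l' "[hy]"] by simp_all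
      ultimately show ?thesis using meetI h Corner.prems(2,3) 1 by metis
    next
      case 2
      have "meet lab (?f ` set (cols l l' pre [?h, l'] k s)) (Cor z) (Lo i)
        \<and> meet lab (?f ` set (cols l l' pre [?h, l'] k s)) (Cor z) (Hi i)"
      proof (rule Corner.IH(1)[OF _ Corner.prems(2-5) _ _ 2])
        show "lab (k + i) = items s ! i" if "i < sz s" for i
          using lab[of i] that by (simp add: nth_append)
      qed (use h in auto)
      moreover have "?f ` set (cols l l' pre [?h, l'] k s) \<subseteq> ?f ` set (cols l l' pre suf k (Corner w s t))"
        unfolding eq by blast
      ultimately show ?thesis by (blast intro: meet_mono)
    next
      case 3
      have "meet lab (?f ` set (cols l l' [l, ?h] suf (Suc ?h) t)) (Cor z) (Lo i)
        \<and> meet lab (?f ` set (cols l l' [l, ?h] suf (Suc ?h) t)) (Cor z) (Hi i)"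
      proof (rule Corner.IH(2)[OF _ Corner.prems(2,3) _ _ Corner.prems(6,7) 3])
        show "lab (Suc ?h + i) = items t ! i" if "i < sz t" for i
          using lab[of "Suc (sz s + i)"] that by (simp add: nth_append add.assoc)
      qed (use h in auto)
      moreover have "?f ` set (cols l l' [l, ?h] suf (Suc ?h) t) \<subseteq> ?f ` set (cols l l' pre suf k (Corner w s t))"
        unfolding eq by blast
      ultimately show ?thesis by (blast intro: meet_mono)
    qed
  next
    case (Polygon q t)
    let ?f = "\<lambda>c. hx # c @ [hy]"
    let ?h = "Suc (k + sz t)"
    let ?X = "{[k]} \<union> set (cols k ?h [] [] (Suc k) t) \<union> {[?h]}"
    have lab: "lab (k + n) = (Lo q # items t @ [Hi q]) ! n" if "n < Suc (Suc (sz t))" for n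
      using Polygon.prems(1) that by simp
    have kh: "lab k = Lo q" "lab ?h = Hi q" using lab[of 0] lab[of "Suc (sz t)"] by (auto simp: nth_append)
    have eq: "set (cols l l' pre suf k (Polygon q t)) = (\<lambda>c. pre @ c @ suf) ` ?X"
      by (auto simp: Let_def)
    \<comment> \<open>The new polygon lies between the nearest corners below and above; the bars
      beyond these are added afterwards by \<open>meet_append\<close>.\<close>
    let ?hx = "last (hx # pre)" and ?hy = "hd (suf @ [hy])"
    have 1: "hx # pre = butlast (hx # pre) @ [?hx]" by simp
    have 2: "suf @ [hy] = ?hy # tl (suf @ [hy])" by simp
    have f: "?f (pre @ c @ suf) = butlast (hx # pre) @ (?hx # c @ [?hy]) @ tl (suf @ [hy])" for c
      using 1 2 by (metis append.assoc append_Cons append_Nil)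
    have lift: "meet lab ((\<lambda>c. ?hx # c @ [?hy]) ` ?X) a b \<Longrightarrow> meet lab (?f ` set (cols l l' pre suf k (Polygon q t))) a b" for a b
      using meet_append[of lab "(\<lambda>c. ?hx # c @ [?hy]) ` ?X" a b "butlast (hx # pre)" "tl (suf @ [hy])"]
      unfolding eq image_image f by simp
    have "meet lab ((\<lambda>c. ?hx # c @ [?hy]) ` ?X) (Cor z) (Lo i) \<and> meet lab ((\<lambda>c. ?hx # c @ [?hy]) ` ?X) (Cor z) (Hi i)"
    proof (cases "(z, i) \<in> cells q x y t")
      case True
      have "meet lab ((\<lambda>c. ?hx # c @ [?hy]) ` set (cols k ?h [] [] (Suc k) t)) (Cor z) (Lo i)
        \<and> meet lab ((\<lambda>c. ?hx # c @ [?hy]) ` set (cols k ?h [] [] (Suc k) t)) (Cor z) (Hi i)"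
      proof (rule Polygon.IH[OF _ kh _ _ _ _ True])
        show "lab (Suc k + n) = items t ! n" if "n < sz t" for n
          using lab[of "Suc n"] that by (simp add: nth_append)
      qed (use Polygon.prems in auto)
      then show ?thesis using meet_mono[of lab "(\<lambda>c. ?hx # c @ [?hy]) ` set (cols k ?h [] [] (Suc k) t)" _ _ "(\<lambda>c. ?hx # c @ [?hy]) ` ?X"]
        by blast
    next
      case False
      then have zi: "i = q" "z = x \<or> z = y" using Polygon.prems(8) by auto
      \<comment> \<open>Between the two corners \<open>Lo q\<close> stands alone in the column
        \<open>[k]\<close>, and \<open>Hi q\<close> in \<open>[?h]\<close>; these columns provide
        the incidences with the ends of the chord.\<close>
      have col: "?hx # [w] @ [?hy] \<in> (\<lambda>c. ?hx # c @ [?hy]) ` ?X" if "w = k \<or> w = ?h" for w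
        using that by blast
      have "consecutive_in (?hx # [w] @ [?hy]) ?hx w" "consecutive_in (?hx # [w] @ [?hy]) w ?hy" for w
        using consecutive_inI[of "[]" ?hx w "[?hy]"] consecutive_inI[of "[?hx]" w ?hy "[]"] by simp_all
      then show ?thesis
        using zi kh Polygon.prems(5,7) col[of k] col[of ?h] meetI by metis
    qed
    then show ?case using lift by blast
  qed simp
  then show "meet lab ((\<lambda>c. hx # c @ [hy]) ` set (cols l l' pre suf k t)) (Cor z) (Lo i)"
    and "meet lab ((\<lambda>c. hx # c @ [hy]) ` set (cols l l' pre suf k t)) (Cor z) (Hi i)" by blast+
qed

section \<open>From a dissection to a representation\<close>

lemma count_items:
  "count_list (items t) (Cor z) = count (corners t) z"
  "count_list (items t) (Lo j) = count (polygons t) j"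
  "count_list (items t) (Hi j) = count (polygons t) j"
  by (induction t) auto

lemma card_nth_eq_count_list: "card {i. i < length xs \<and> xs ! i = x} = count_list xs x"
  by (simp add: count_list_eq_length_filter length_filter_conv_card eq_commute[of x])

text \<open>The ends of the outermost chord become two bars, \<open>x\<close> at the bottom and
  \<open>y\<close> on top, that span all columns. A label has one bar for each of its occurrences,
  which \<open>cnt\<close> bounds, and one incidence in \<open>cells\<close> yields two adjacencies,
  with the \<open>Lo\<close> and with the \<open>Hi\<close> vertex.\<close>

theorem dissection_rep:
  fixes G :: "('a, 'b) pre_digraph" and t :: "('c, 'p) dis" and g :: "('c, 'p) item \<Rightarrow> 'a"
  assumes V: "verts G = U \<union> W" and arcs: "arcs_ends G = U \<times> W \<union> W \<times> U"
    and g: "inj_on g (Cor ` C \<union> Lo ` P \<union> Hi ` P)" "g ` Cor ` C = U" "g ` (Lo ` P \<union> Hi ` P) = W"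
    and lab: "set (Cor x # items (Polygon j s) @ [Cor y]) \<subseteq> Cor ` C \<union> Lo ` P \<union> Hi ` P"
    and cov: "C \<times> P \<subseteq> cells e x y (Polygon j s)"
    and cnt: "\<And>z. z \<in> C \<Longrightarrow> count (add_mset x (add_mset y (corners s))) z \<le> b"
      "\<And>i. i \<in> P \<Longrightarrow> count (polygons (Polygon j s)) i \<le> b"
  shows "\<exists>f. bar_visibility_rep b G f"
proof -
  let ?t = "Polygon j s"
  define its where "its = Cor x # items ?t @ [Cor y]"
  define h where "h = Suc (Suc (sz s))"
  define N where "N = Suc h"
  \<comment> \<open>The outermost chord has no polygon on its near side: the bars 0 and
    \<open>N\<close> around \<open>?t\<close> are corners. So the lemmas on columns are applied to
    \<open>s\<close> with the bars 1 and \<open>h\<close> of polygon \<open>j\<close>.\<close>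
  let ?X = "[[1]] @ cols 1 h [] [] 2 s @ [[h]]"
  define X where "X = ?X"
  define cs where "cs = map (\<lambda>c. 0 # c @ [N]) X"
  have Xcols: "X = cols 0 N [] [] 1 ?t" unfolding X_def by (simp add: Let_def h_def numeral_2_eq_2)
  define lab where "lab = nth its"
  have len: "length its = Suc N" by (simp add: its_def N_def h_def)
  have labs: "lab 0 = Cor x" "lab N = Cor y"
    by (auto simp: lab_def its_def N_def h_def nth_append)
  have lab1: "lab 1 = Lo j" "lab h = Hi j" "\<And>i. i < sz s \<Longrightarrow> lab (2 + i) = items s ! i"
    by (auto simp: lab_def its_def h_def nth_append)
  have fr: "frame 1 h [] [] 2 (sz s)" by (simp add: frame_def h_def)
  have Xb: "v \<in> {1..h}" if "c \<in> set X" "v \<in> set c" for c v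
    using cols_bound[of c 1 h "[]" "[]" 2 s v] that by (auto simp: X_def h_def)
  have Xs: "sorted_wrt (<) c" if "c \<in> set X" for c
    using cols_sorted[OF fr] that by (auto simp: X_def)
  have Xa: "c \<noteq> [] \<and> alt lab c \<and> \<not> isCor (lab (hd c)) \<and> \<not> isCor (lab (last c))" if "c \<in> set X" for c
    using that cols_alternating[of s lab 2 1 j h "[]" "[]" c] lab1 by (auto simp: X_def)
  have Xctg: "one_run v X" for v
  proof (cases "v \<in> {1..h}")
    case True
    note IH = cols_contiguous[OF fr]
    consider "v = 1" | "v = h" | "v \<in> {2..<2 + sz s}" using True by (fastforce simp: h_def)
    then show ?thesis
    proof cases
      case 1
      have "initial_run 1 ?X" by (intro initial_run_intros(3,4)) (use IH in \<open>auto simp: h_def\<close>)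
      with 1 show ?thesis by (simp only: X_def one_run_intros(1))
    next
      case 2
      have "final_run h ?X" by (intro final_run_intros(3,4)) (use IH in \<open>auto simp: h_def\<close>)
      with 2 show ?thesis by (simp only: X_def one_run_intros(2))
    next
      case 3
      have "one_run v ?X" by (intro one_run_intros(4,5)) (use IH 3 in \<open>auto simp: h_def\<close>)
      then show ?thesis by (simp only: X_def)
    qed
  next
    case False
    then show ?thesis using Xb by (intro one_run_intros(1) initial_run_intros(2)) blast
  qed
  have csE: "\<exists>c'\<in>set X. c = 0 # c' @ [N]" if "c \<in> set cs" for c using that by (auto simp: cs_def)
  have gU: "g i \<in> U" if "isCor i" "i \<in> set its" for i
  proof -
    have "i \<in> Cor ` C \<union> Lo ` P \<union> Hi ` P" using that(2) lab unfolding its_def by (rule subsetD[rotated])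
    then have "i \<in> Cor ` C" using that(1) by auto
    then show ?thesis using g(2) by blast
  qed
  have gW: "g i \<in> W" if "\<not> isCor i" "i \<in> set its" for i
  proof -
    have "i \<in> Cor ` C \<union> Lo ` P \<union> Hi ` P" using that(2) lab unfolding its_def by (rule subsetD[rotated])
    then have "i \<in> Lo ` P \<union> Hi ` P" using that(1) by auto
    then show ?thesis using g(3) by blast
  qed
  show ?thesis
  proof (rule layout_rep[of cs "map g its"])
    fix c assume c: "c \<in> set cs"
    then obtain c' where c': "c' \<in> set X" "c = 0 # c' @ [N]" using csE by blast
    then show "sorted_wrt (<) c" using Xs[OF c'(1)] Xb[OF c'(1)] by (fastforce simp: sorted_wrt_append N_def h_def)
    fix v assume "v \<in> set c"
    then show "v < length (map g its)" using Xb[OF c'(1)] c' len by (fastforce simp: N_def)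
  next
    fix v assume "v < length (map g its)"
    then consider "v = 0" | "v = N" | "v \<in> {1..<1 + sz ?t}" using len by (fastforce simp: N_def h_def)
    then show "\<exists>c\<in>set cs. v \<in> set c"
    proof cases
      case 3
      then show ?thesis using cols_cover[of v 1 ?t 0 N "[]" "[]"] by (auto simp: cs_def Xcols)
    qed (auto simp: cs_def X_def)
  next
    fix v i k l assume *: "i \<le> k" "k \<le> l" "l < length cs" "v \<in> set (cs ! i)" "v \<in> set (cs ! l)"
    show "v \<in> set (cs ! k)"
    proof (cases "v = 0 \<or> v = N")
      case True then show ?thesis using * by (auto simp: cs_def)
    next
      case False
      have "one_run v cs" unfolding cs_def by (rule one_run_map[OF _ Xctg]) (use False in auto)
      then show ?thesis using one_run_nth * by metis
    qed
  next
    fix xs u v ys assume c: "xs @ [u, v] @ ys \<in> set cs"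
    then obtain c' where c': "c' \<in> set X" "xs @ [u, v] @ ys = 0 # c' @ [N]" using csE by blast
    have "alt lab (0 # c' @ [N])" using Xa[OF c'(1)] labs by (auto simp: successively_Cons successively_append_iff)
    then have "alt lab (xs @ [u, v] @ ys)" using c'(2) by simp
    then have ne: "isCor (lab u) \<noteq> isCor (lab v)" by (simp add: successively_append_iff)
    have "w < length its" if "w \<in> set (0 # c' @ [N])" for w
      using that Xb[OF c'(1)] len by (fastforce simp: N_def)
    then have uv: "u < length its" "v < length its" using c'(2) by (metis in_set_conv_decomp append_Cons append_Nil append.assoc)+
    then have "lab u \<in> set its" "lab v \<in> set its" by (auto simp: lab_def)
    then have "g (lab u) \<in> U \<and> g (lab v) \<in> W \<or> g (lab u) \<in> W \<and> g (lab v) \<in> U"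
      using gU gW ne by metis
    then show "map g its ! u \<rightarrow>\<^bsub>G\<^esub> map g its ! v \<and> map g its ! v \<rightarrow>\<^bsub>G\<^esub> map g its ! u"
      using uv by (auto simp: arcs lab_def)
  next
    fix a b assume "a \<rightarrow>\<^bsub>G\<^esub> b"
    then obtain u w where uw: "u \<in> U" "w \<in> W" "a = u \<and> b = w \<or> a = w \<and> b = u" by (auto simp: arcs)
    obtain z where z: "z \<in> C" "g (Cor z) = u" using uw g(2) by auto
    obtain i I where i: "i \<in> P" "I = Lo i \<or> I = Hi i" "g I = w" using uw g(3) by auto
    have zi: "(z, i) \<in> cells e x y ?t" using cov z i by blast
    have "set cs = (\<lambda>c. 0 # c @ [N]) ` set (cols 0 N [] [] 1 ?t)" by (simp add: cs_def Xcols)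
    moreover have "meet lab ((\<lambda>c. 0 # c @ [N]) ` set (cols 0 N [] [] 1 ?t)) (Cor z) I"
    proof -
      have zi': "(z, i) = (x, j) \<or> (z, i) = (y, j) \<or> (z, i) \<in> cells j x y s" using zi by auto
      show ?thesis
      proof (cases "(z, i) \<in> cells j x y s")
        case True
        have "meet lab ((\<lambda>c. 0 # c @ [N]) ` set (cols 1 h [] [] 2 s)) (Cor z) I"
          using cols_meet[where t = s and lab = lab and k = 2 and l = 1 and l' = h and hx = 0 and hy = N, OF lab1(3,1,2) _ _ _ _ True] i(2) labs
          by auto
        then show ?thesis by (rule meet_mono) (unfold Xcols[symmetric] X_def, auto)
      next
        case False
        then have zi: "i = j" "z = x \<or> z = y" using zi' by auto
        have col: "0 # [w] @ [N] \<in> (\<lambda>c. 0 # c @ [N]) ` set (cols 0 N [] [] 1 ?t)" if "w = 1 \<or> w = h" for w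
          using that unfolding Xcols[symmetric] X_def by auto
        have "consecutive_in (0 # [w] @ [N]) 0 w" "consecutive_in (0 # [w] @ [N]) w N" for w
          using consecutive_inI[of "[]" 0 w "[N]"] consecutive_inI[of "[0]" w N "[]"] by simp_all
        moreover obtain w where w: "w = 1 \<or> w = h" "lab w = I" using zi(1) lab1(1,2) i(2) by auto
        ultimately show ?thesis
          using zi(2) labs(1,2) meetI(1)[OF col[OF w(1)], of 0 w lab "Cor z" I] meetI(2)[OF col[OF w(1)], of w N lab I "Cor z"] w(2)
          by blast
      qed
    qed
    ultimately obtain c u' v' where c: "c \<in> set cs" "consecutive_in c u' v'" "lab u' = Cor z \<and> lab v' = I \<or> lab u' = I \<and> lab v' = Cor z"
      unfolding meet_def by auto
    then obtain xs ys where xy: "xs @ [u', v'] @ ys \<in> set cs" unfolding consecutive_in_def by blast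
    then obtain c' where c': "c' \<in> set X" "xs @ [u', v'] @ ys = 0 # c' @ [N]" using csE by blast
    have "w < length its" if "w \<in> set (0 # c' @ [N])" for w
      using that Xb[OF c'(1)] len by (fastforce simp: N_def)
    then have "u' < length its" "v' < length its" using c'(2) by (metis in_set_conv_decomp append_Cons append_Nil append.assoc)+
    then have "map g its ! u' = u \<and> map g its ! v' = w \<or> map g its ! u' = w \<and> map g its ! v' = u"
      using c(3) z i by (auto simp: lab_def)
    then show "\<exists>xs u v ys. xs @ [u, v] @ ys \<in> set cs \<and> (map g its ! u = a \<and> map g its ! v = b \<or> map g its ! u = b \<and> map g its ! v = a)"
      using xy uw(3) by metis
  next
    fix v assume v: "v \<in> verts G"
    let ?D = "Cor ` C \<union> Lo ` P \<union> Hi ` P"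
    have inj: "inj_on g ?D" by (rule g(1))
    have "v \<in> g ` ?D" using v V g(2,3) by (auto simp: image_Un)
    then obtain i where i: "i \<in> ?D" "v = g i" by blast
    have "{k. k < length (map g its) \<and> map g its ! k = v} = {k. k < length its \<and> its ! k = i}"
    proof -
      have "g (its ! k) = g i \<longleftrightarrow> its ! k = i" if "k < length its" for k
      proof -
        have "its ! k \<in> ?D" using lab nth_mem[OF that] unfolding its_def by blast
        then show ?thesis using inj_on_eq_iff[OF inj _ i(1)] by blast
      qed
      then show ?thesis using i by auto
    qed
    then have "card {k. k < length (map g its) \<and> map g its ! k = v} = count_list its i"
      by (simp only: card_nth_eq_count_list)
    also have "\<dots> \<le> b"
    proof -
      consider z where "z \<in> C" "i = Cor z" | q where "q \<in> P" "i = Lo q" | q where "q \<in> P" "i = Hi q" using i(1) by blast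
      then show ?thesis
      proof cases
        case (1 z) then show ?thesis using cnt(1)[of z] by (simp add: its_def count_items split: if_splits)
      next
        case (2 q) then show ?thesis using cnt(2)[of q] by (simp add: its_def count_items split: if_splits)
      next
        case (3 q) then show ?thesis using cnt(2)[of q] by (simp add: its_def count_items split: if_splits)
      qed
    qed
    finally show "card {k. k < length (map g its) \<and> map g its ! k = v} \<le> b" .
  next
    show "set (map g its) \<subseteq> verts G" using gU gW V by auto
  qed
qed

section \<open>Assembling a dissection from polygons\<close>

text \<open>The chords and sides at which another dissection can be glued in. Unordered pairs
  suffice, as dissections can be mirrored.\<close>

fun ports :: "'c \<Rightarrow> 'c \<Rightarrow> ('c, 'p) dis \<Rightarrow> 'c set set" where
  "ports x y Side = {{x, y}}"
| "ports x y (Corner z s t) = ports x z s \<union> ports z y t"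
| "ports x y (Polygon j t) = insert {x, y} (ports x y t)"

fun mirror :: "('c, 'p) dis \<Rightarrow> ('c, 'p) dis" where
  "mirror Side = Side"
| "mirror (Corner z s t) = Corner z (mirror t) (mirror s)"
| "mirror (Polygon j t) = Polygon j (mirror t)"

text \<open>Such a dissection adds no corner to a polygon on the near side, so it can be glued along
  any chord, and its \<open>cells\<close> do not depend on \<open>e\<close>.\<close>

fun chordal :: "('c, 'p) dis \<Rightarrow> bool" where
  "chordal (Corner z s t) = False" | "chordal _ = True"

lemma mirror_simps:
  "corners (mirror t) = corners t" "polygons (mirror t) = polygons t" "cells e y x (mirror t) = cells e x y t"
  "ports y x (mirror t) = ports x y t" "chordal (mirror t) = chordal t"
proof -
  show "corners (mirror t) = corners t" "polygons (mirror t) = polygons t"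
    by (induction t) (auto simp: add.commute)
  show "cells e y x (mirror t) = cells e x y t" by (induction t arbitrary: e x y) auto
  show "ports y x (mirror t) = ports x y t" by (induction t arbitrary: x y) (auto simp: insert_commute)
  show "chordal (mirror t) = chordal t" by (cases t) auto
qed

lemma chordal_cells: "chordal t \<Longrightarrow> cells e x y t = cells e' x y t"
  by (cases t) auto

text \<open>This forgets the shape of the tree. The two multisets are exact because they count bars;
  incidences and ports only have to exist, so \<open>X\<close> and \<open>R\<close> are lower
  bounds.\<close>

definition fills :: "'c \<Rightarrow> 'c \<Rightarrow> 'c multiset \<Rightarrow> 'p multiset \<Rightarrow> ('c \<times> 'p) set \<Rightarrow> 'c set set \<Rightarrow> bool" where
  "fills x y K M X R \<longleftrightarrow>
     (\<exists>t. chordal t \<and> corners t = K \<and> polygons t = M \<and> (\<forall>e. X \<subseteq> cells e x y t) \<and> R \<subseteq> ports x y t)"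

lemma fillsI:
  assumes "chordal t" "corners t = K" "polygons t = M" "X \<subseteq> cells e x y t" "R \<subseteq> ports x y t"
  shows "fills x y K M X R"
proof -
  have "X \<subseteq> cells e' x y t" for e' using assms(4) chordal_cells[OF assms(1), of e x y e'] by simp
  then show ?thesis unfolding fills_def using assms by blast
qed

lemma fills_commute:
  assumes "fills x y K M X R" shows "fills y x K M X R"
proof -
  obtain t where "chordal t" "corners t = K" "polygons t = M" "\<And>e. X \<subseteq> cells e x y t" "R \<subseteq> ports x y t"
    using assms unfolding fills_def by blast
  then show ?thesis by (intro fillsI[of "mirror t"]) (simp_all add: mirror_simps)
qed

lemma fills_Side: "fills x y {#} {#} {} {{x, y}}"
  by (rule fillsI[of Side]) auto

text \<open>The assumption \<open>loop\<close> describes a cycle of polygons that begins and ends at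
  a chord with the labels \<open>u\<close> and \<open>v\<close>: it goes between such a chord and
  whatever filled the chord before. The induction descends to a place where these labels
  occur.\<close>

lemma insert_loop_tree:
  assumes loop: "\<And>K M X R. fills u v K M X R \<Longrightarrow> fills u v (K + KZ) (M + MZ) (X \<union> XZ) (R \<union> RZ)"
    and "{u, v} \<in> ports x y t"
  shows "\<exists>t'. corners t' = corners t + KZ \<and> polygons t' = polygons t + MZ \<and>
    (\<forall>e. cells e x y t \<union> XZ \<subseteq> cells e x y t') \<and> ports x y t \<union> RZ \<subseteq> ports x y t' \<and> (chordal t \<longrightarrow> chordal t')"
  using assms(2)
proof (induction t arbitrary: x y)
  case (Corner z s t)
  then consider "{u, v} \<in> ports x z s" | "{u, v} \<in> ports z y t" by auto
  then show ?case
  proof cases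
    case 1
    from Corner.IH(1)[OF this] obtain s' where "corners s' = corners s + KZ \<and> polygons s' = polygons s + MZ \<and>
      (\<forall>e. cells e x z s \<union> XZ \<subseteq> cells e x z s') \<and> ports x z s \<union> RZ \<subseteq> ports x z s'" by blast
    then show ?thesis by (intro exI[of _ "Corner z s' t"]) auto
  next
    case 2
    from Corner.IH(2)[OF this] obtain t' where "corners t' = corners t + KZ \<and> polygons t' = polygons t + MZ \<and>
      (\<forall>e. cells e z y t \<union> XZ \<subseteq> cells e z y t') \<and> ports z y t \<union> RZ \<subseteq> ports z y t'" by blast
    then show ?thesis by (intro exI[of _ "Corner z s t'"]) auto
  qed
next
  case Side
  have "fills u v (corners Side) (polygons Side) (cells undefined x y Side) (ports x y Side)"
    using Side fills_Side[of u v] by (auto simp: doubleton_eq_iff insert_commute)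
  from loop[OF this] have "fills x y (corners Side + KZ) (polygons Side + MZ) (cells undefined x y Side \<union> XZ) (ports x y Side \<union> RZ)"
    using Side fills_commute by (fastforce simp: doubleton_eq_iff)
  then show ?case unfolding fills_def by auto
next
  case (Polygon j t)
  show ?case
  proof (cases "{u, v} \<in> ports x y t")
    case True
    from Polygon.IH[OF this] obtain t' where "corners t' = corners t + KZ \<and> polygons t' = polygons t + MZ \<and>
      (\<forall>e. cells e x y t \<union> XZ \<subseteq> cells e x y t') \<and> ports x y t \<union> RZ \<subseteq> ports x y t'" by blast
    then show ?thesis by (intro exI[of _ "Polygon j t'"]) auto
  next
    case False
    let ?t = "Polygon j t"
    have xy: "u = x \<and> v = y \<or> u = y \<and> v = x" using False Polygon.prems by (auto simp: doubleton_eq_iff)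
    have "fills x y (corners ?t) (polygons ?t) (cells j x y ?t) (ports x y ?t)"
      by (rule fillsI[of ?t]) auto
    then have "fills u v (corners ?t) (polygons ?t) (cells j x y ?t) (ports x y ?t)"
      using xy by (metis fills_commute)
    from loop[OF this] have "fills x y (corners ?t + KZ) (polygons ?t + MZ) (cells j x y ?t \<union> XZ) (ports x y ?t \<union> RZ)"
      using xy by (metis fills_commute)
    then obtain t' where t': "chordal t'" "corners t' = corners ?t + KZ" "polygons t' = polygons ?t + MZ"
      "\<And>e. cells j x y ?t \<union> XZ \<subseteq> cells e x y t'" "ports x y ?t \<union> RZ \<subseteq> ports x y t'"
      unfolding fills_def by blast
    moreover have "cells e x y ?t = cells j x y ?t" for e by simp
    ultimately show ?thesis by (intro exI[of _ t']) simp
  qed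
qed

lemma fills_insert_loop:
  assumes loop: "\<And>K M X R. fills u v K M X R \<Longrightarrow> fills u v (K + KZ) (M + MZ) (X \<union> XZ) (R \<union> RZ)"
    and f: "fills x y K M X R" and "{u, v} \<in> R"
  shows "fills x y (K + KZ) (M + MZ) (X \<union> XZ) (R \<union> RZ)"
proof -
  obtain t where t: "chordal t" "corners t = K" "polygons t = M" "\<And>e. X \<subseteq> cells e x y t" "R \<subseteq> ports x y t"
    using f unfolding fills_def by blast
  then have "{u, v} \<in> ports x y t" using assms(3) by blast
  from insert_loop_tree[OF loop this] obtain t' where t': "corners t' = corners t + KZ \<and> polygons t' = polygons t + MZ \<and>
    (\<forall>e. cells e x y t \<union> XZ \<subseteq> cells e x y t') \<and> ports x y t \<union> RZ \<subseteq> ports x y t' \<and> (chordal t \<longrightarrow> chordal t')"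
    by blast
  have "X \<union> XZ \<subseteq> cells undefined x y t'" using t(4)[of undefined] t' by blast
  moreover have "R \<union> RZ \<subseteq> ports x y t'" using t(5) t' by blast
  ultimately show ?thesis using t t' by (intro fillsI[of t']) auto
qed

text \<open>
  Corners are numbered cyclically by \<open>\<rho>\<close>, and every polygon has consecutive corners.
  In \<open>fan \<rho> c k T\<close> the chord from corner \<open>c + k + 1\<close> to corner \<open>c\<close> is cut off by the corners in between, and
  \<open>T\<close> is glued to the side between \<open>c + k + 1\<close> and \<open>c + k\<close>.
\<close>

fun fan :: "(int \<Rightarrow> 'c) \<Rightarrow> int \<Rightarrow> nat \<Rightarrow> ('c, 'p) dis \<Rightarrow> ('c, 'p) dis" where
  "fan \<rho> c 0 T = T"
| "fan \<rho> c (Suc k) T = Corner (\<rho> (c + int (Suc k))) T (fan \<rho> c k Side)"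

definition edge :: "(int \<Rightarrow> 'c) \<Rightarrow> int \<Rightarrow> 'c set" where
  "edge \<rho> d = {\<rho> (d - 1), \<rho> d}"

lemma greaterThanAtMost_Suc: "{c<..c + int (Suc k)} = insert (c + int (Suc k)) {c<..c + int k}"
  by auto

lemma fan_simps:
  "corners (fan \<rho> c k T) = corners T + image_mset \<rho> (mset_set {c<..c + int k})"
  "polygons (fan \<rho> c k T) = polygons T"
  "cells e (\<rho> (c + int (Suc k))) (\<rho> c) (fan \<rho> c k T) = cells e (\<rho> (c + int (Suc k))) (\<rho> (c + int k)) T \<union> (\<lambda>d. (\<rho> d, e)) ` {c<..c + int k}"
  "ports (\<rho> (c + int (Suc k))) (\<rho> c) (fan \<rho> c k T) = ports (\<rho> (c + int (Suc k))) (\<rho> (c + int k)) T \<union> edge \<rho> ` {c<..c + int k}"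
proof -
  show "corners (fan \<rho> c k T) = corners T + image_mset \<rho> (mset_set {c<..c + int k})"
  proof (induction k arbitrary: T)
    case (Suc k)
    then show ?case by (simp add: greaterThanAtMost_Suc del: of_nat_Suc)
  qed simp
  show "polygons (fan \<rho> c k T) = polygons T"
    by (induction k arbitrary: T) auto
  show "cells e (\<rho> (c + int (Suc k))) (\<rho> c) (fan \<rho> c k T) = cells e (\<rho> (c + int (Suc k))) (\<rho> (c + int k)) T \<union> (\<lambda>d. (\<rho> d, e)) ` {c<..c + int k}"
  proof (induction k arbitrary: T)
    case (Suc k)
    show ?case using Suc[of Side] by (simp add: greaterThanAtMost_Suc Un_commute del: of_nat_Suc)
  qed simp
  show "ports (\<rho> (c + int (Suc k))) (\<rho> c) (fan \<rho> c k T) = ports (\<rho> (c + int (Suc k))) (\<rho> (c + int k)) T \<union> edge \<rho> ` {c<..c + int k}"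
  proof (induction k arbitrary: T)
    case (Suc k)
    have "edge \<rho> (c + int (Suc k)) = {\<rho> (c + int (Suc k)), \<rho> (c + int k)}"
      by (auto simp: edge_def)
    then show ?case using Suc[of Side] by (simp add: greaterThanAtMost_Suc del: of_nat_Suc)
  qed simp
qed

text \<open>A polygon with the corners \<open>c - 1, \<dots>, c + l\<close> is attached at chord
  \<open>c\<close>, whose ends are its first two corners, and is continued at chord
  \<open>c + l\<close>. If \<open>l > 0\<close>, its side from corner \<open>c + l\<close> back to
  \<open>c - 1\<close> stays a side of the disk; for \<open>l = 0\<close> it is a digon.\<close>

lemma fills_arc:
  assumes "fills (\<rho> (c + int l - 1)) (\<rho> (c + int l)) K M X R"
  shows "fills (\<rho> (c - 1)) (\<rho> c) (K + image_mset \<rho> (mset_set {c<..c + int l})) (add_mset j M)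
    (X \<union> (\<lambda>d. (\<rho> d, j)) ` {c - 1..c + int l}) (R \<union> edge \<rho> ` {c..c + int l})"
proof -
  obtain t where t: "chordal t" "corners t = K" "polygons t = M"
    "\<And>e. X \<subseteq> cells e (\<rho> (c + int l - 1)) (\<rho> (c + int l)) t" "R \<subseteq> ports (\<rho> (c + int l - 1)) (\<rho> (c + int l)) t"
    using assms unfolding fills_def by blast
  show ?thesis
  proof (cases l)
    case 0
    show ?thesis
    proof (rule fillsI[of "Polygon j t"])
      have "{c - 1..c + int l} = {c - 1, c}" "{c..c + int l} = {c}" using 0 by auto
      then show "X \<union> (\<lambda>d. (\<rho> d, j)) ` {c - 1..c + int l} \<subseteq> cells j (\<rho> (c - 1)) (\<rho> c) (Polygon j t)"
        "R \<union> edge \<rho> ` {c..c + int l} \<subseteq> ports (\<rho> (c - 1)) (\<rho> c) (Polygon j t)"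
        using t(4)[of j] t(5) 0 by (auto simp: edge_def)
    qed (use t 0 in auto)
  next
    case (Suc k)
    \<comment> \<open>\<open>fan\<close> walks from the last corner back to \<open>c\<close>, so it
      meets chord \<open>c + l\<close> with the ends exchanged; hence the mirror image.\<close>
    let ?f = "fan \<rho> c k (mirror t)"
    let ?t = "Polygon j (Corner (\<rho> (c + int (Suc k))) Side ?f)"
    have i1: "{c - 1..c + int (Suc k)} = {c - 1, c, c + int (Suc k)} \<union> {c<..c + int k}"
      and i2: "{c..c + int (Suc k)} = {c, c + int (Suc k)} \<union> {c<..c + int k}" by auto
    have k1: "c + int (Suc k) - 1 = c + int k" by simp
    note t' = t(4,5)[unfolded Suc k1]
    have cl: "X \<subseteq> cells j (\<rho> (c + int (Suc k))) (\<rho> (c + int k)) (mirror t)"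
      using t'(1) by (simp add: mirror_simps del: of_nat_Suc)
    have pt: "R \<subseteq> ports (\<rho> (c + int (Suc k))) (\<rho> (c + int k)) (mirror t)"
      using t'(2) by (simp add: mirror_simps del: of_nat_Suc)
    have "edge \<rho> (c + int (Suc k)) \<in> ports (\<rho> (c + int (Suc k))) (\<rho> (c + int k)) (mirror t)"
      using t(1) by (cases t) (auto simp: edge_def insert_commute)
    then have ports: "R \<union> edge \<rho> ` {c..c + int l} \<subseteq> ports (\<rho> (c - 1)) (\<rho> c) ?t"
      unfolding Suc i2 using pt by (simp add: fan_simps edge_def del: of_nat_Suc) blast
    have "X \<union> (\<lambda>d. (\<rho> d, j)) ` {c - 1..c + int l} \<subseteq> cells j (\<rho> (c - 1)) (\<rho> c) ?t"
      unfolding Suc i1 using cl by (simp add: fan_simps del: of_nat_Suc) blast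
    from this ports show ?thesis
    proof (rule fillsI[rotated 3])
      show "corners ?t = K + image_mset \<rho> (mset_set {c<..c + int l})"
        using t(2) by (simp add: Suc fan_simps mirror_simps greaterThanAtMost_Suc del: of_nat_Suc)
      show "polygons ?t = add_mset j M" using t(3) by (simp add: fan_simps mirror_simps)
    qed simp
  qed
qed

text \<open>
  A polygon of the family \<open>A\<close> is given by its first chord \<open>s i\<close>, where chord \<open>c\<close> joins the corners \<open>c - 1\<close> and \<open>c\<close>,
  the number \<open>l i\<close> of its further corners, and its label \<open>j i\<close>; it can be continued at its last chord \<open>s i + l i\<close>.
\<close>

locale polygon_family =
  fixes m :: int and \<rho> :: "int \<Rightarrow> 'c" and s :: "'i \<Rightarrow> int" and l :: "'i \<Rightarrow> nat" and j :: "'i \<Rightarrow> 'p"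
  assumes m2: "2 \<le> m" and periodic: "\<And>d. \<rho> d = \<rho> (d mod m)"
begin

section \<open>Trails and cycles of polygons\<close>

definition family_corners :: "'i set \<Rightarrow> 'c multiset" where
  "family_corners A = (\<Sum>i\<in>A. image_mset \<rho> (mset_set {s i<..s i + int (l i)}))"

definition family_polygons :: "'i set \<Rightarrow> 'p multiset" where
  "family_polygons A = image_mset j (mset_set A)"

definition family_cells :: "'i set \<Rightarrow> ('c \<times> 'p) set" where
  "family_cells A = (\<Union>i\<in>A. (\<lambda>d. (\<rho> d, j i)) ` {s i - 1..s i + int (l i)})"

definition family_ports :: "'i set \<Rightarrow> 'c set set" where
  "family_ports A = (\<Union>i\<in>A. edge \<rho> ` {s i..s i + int (l i)})"

lemma family_insert:
  assumes "finite A" "i \<notin> A"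
  shows "family_corners (insert i A) = image_mset \<rho> (mset_set {s i<..s i + int (l i)}) + family_corners A"
    "family_polygons (insert i A) = add_mset (j i) (family_polygons A)"
    "family_cells (insert i A) = (\<lambda>d. (\<rho> d, j i)) ` {s i - 1..s i + int (l i)} \<union> family_cells A"
    "family_ports (insert i A) = edge \<rho> ` {s i..s i + int (l i)} \<union> family_ports A"
  using assms by (auto simp: family_corners_def family_polygons_def family_cells_def family_ports_def)

lemma family_empty: "family_corners {} = {#}" "family_polygons {} = {#}" "family_cells {} = {}" "family_ports {} = {}"
  by (auto simp: family_corners_def family_polygons_def family_cells_def family_ports_def)

lemma family_union:
  assumes "finite A" "Z \<subseteq> A"
  shows "family_corners A = family_corners Z + family_corners (A - Z)" "family_polygons A = family_polygons Z + family_polygons (A - Z)" "family_cells A = family_cells Z \<union> family_cells (A - Z)" "family_ports A = family_ports Z \<union> family_ports (A - Z)"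
proof -
  have fin: "finite Z" using assms finite_subset by blast
  show "family_corners A = family_corners Z + family_corners (A - Z)"
    unfolding family_corners_def by (subst sum.subset_diff[OF assms(2,1)]) (rule add.commute)
  have "mset_set A = mset_set Z + mset_set (A - Z)"
    using mset_set_Union[of Z "A - Z"] assms fin by (simp add: Un_absorb1)
  then show "family_polygons A = family_polygons Z + family_polygons (A - Z)" by (simp add: family_polygons_def)
  show "family_cells A = family_cells Z \<union> family_cells (A - Z)" "family_ports A = family_ports Z \<union> family_ports (A - Z)" using assms(2) by (auto simp: family_cells_def family_ports_def)
qed

text \<open>A trail is given by its effect: it turns every filling of its final chord
  \<open>v\<close> into one of its initial chord \<open>u\<close>. In this form trails compose, and
  a closed trail is a loop as in \<open>fills_insert_loop\<close>.\<close>

definition trail :: "int \<Rightarrow> int \<Rightarrow> 'i set \<Rightarrow> bool" where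
  "trail u v Z \<longleftrightarrow> (\<forall>K M X R. fills (\<rho> (v - 1)) (\<rho> v) K M X R \<longrightarrow>
     fills (\<rho> (u - 1)) (\<rho> u) (K + family_corners Z) (M + family_polygons Z) (X \<union> family_cells Z) (R \<union> family_ports Z))"

lemma trailD:
  "trail u v Z \<Longrightarrow> fills (\<rho> (v - 1)) (\<rho> v) K M X R \<Longrightarrow>
    fills (\<rho> (u - 1)) (\<rho> u) (K + family_corners Z) (M + family_polygons Z) (X \<union> family_cells Z) (R \<union> family_ports Z)"
  unfolding trail_def by (elim allE) (erule mp)

text \<open>The degree condition for an Euler trail from \<open>u\<close> to \<open>v\<close> in the
  directed multigraph on the residues modulo \<open>m\<close> that has an arc from
  \<open>s i\<close> to \<open>s i + l i\<close> for every polygon. If \<open>u\<close> and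
  \<open>v\<close> are congruent, in-degrees and out-degrees agree.\<close>

definition balanced :: "int \<Rightarrow> int \<Rightarrow> 'i set \<Rightarrow> bool" where
  "balanced u v A \<longleftrightarrow> (\<forall>c. card {i\<in>A. s i mod m = c} + of_bool (c = v mod m)
      = card {i\<in>A. (s i + int (l i)) mod m = c} + of_bool (c = u mod m))"

lemma rho_cong: "u mod m = v mod m \<Longrightarrow> \<rho> u = \<rho> v"
  using periodic[of u] periodic[of v] by simp

lemma rho_cong1: "u mod m = v mod m \<Longrightarrow> \<rho> (u - 1) = \<rho> (v - 1)"
  by (rule rho_cong) (rule mod_diff_cong[OF _ refl])

lemma edge_cong: "u mod m = v mod m \<Longrightarrow> edge \<rho> u = edge \<rho> v"
  unfolding edge_def using rho_cong[of u v] rho_cong1[of u v] by simp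

lemma card_remove:
  assumes "finite A" "i \<in> A"
  shows "card {k\<in>A. P k} = card {k\<in>A - {i}. P k} + of_bool (P i)"
proof (cases "P i")
  case True
  then have "{k\<in>A. P k} = insert i {k\<in>A - {i}. P k}" using assms by auto
  then show ?thesis using True assms by simp
next
  case False
  then have "{k\<in>A. P k} = {k\<in>A - {i}. P k}" by auto
  then show ?thesis using False by simp
qed

lemma balanced_remove:
  assumes "finite A" "i \<in> A" "balanced u v A" "u mod m = s i mod m"
  shows "balanced (s i + int (l i)) v (A - {i})"
  unfolding balanced_def
proof
  fix c
  have "card {i\<in>A. s i mod m = c} + of_bool (c = v mod m) = card {i\<in>A. (s i + int (l i)) mod m = c} + of_bool (c = u mod m)"
    using assms(3) unfolding balanced_def by blast
  then show "card {k \<in> A - {i}. s k mod m = c} + of_bool (c = v mod m) =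
         card {k \<in> A - {i}. (s k + int (l k)) mod m = c} + of_bool (c = (s i + int (l i)) mod m)"
    using card_remove[OF assms(1,2), of "\<lambda>k. s k mod m = c"] card_remove[OF assms(1,2), of "\<lambda>k. (s k + int (l k)) mod m = c"]
    unfolding assms(4) by (simp only: eq_commute[of _ c])
qed

lemma balanced_same: "u mod m = v mod m \<Longrightarrow> balanced u v A = balanced w w A"
  by (simp add: balanced_def)

lemma ex_trail:
  assumes "finite A" "balanced u v A"
  shows "\<exists>Z\<subseteq>A. trail u v Z \<and> balanced 0 0 (A - Z) \<and>
    (\<exists>n::nat. (u + int n) mod m = v mod m \<and> (\<forall>d. u \<le> d \<longrightarrow> d \<le> u + int n \<longrightarrow> edge \<rho> d \<in> insert (edge \<rho> u) (family_ports Z)))"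
  using assms
proof (induction "card A" arbitrary: A u rule: less_induct)
  case less
  show ?case
  proof (cases "u mod m = v mod m")
    case True
    have "trail u v {}" unfolding trail_def family_empty
      using rho_cong[OF True] rho_cong1[OF True] by simp
    moreover have "balanced 0 0 (A - {})" using less.prems(2) balanced_same[OF True] by auto
    ultimately have "{} \<subseteq> A \<and> trail u v {} \<and> balanced 0 0 (A - {}) \<and> (u + int 0) mod m = v mod m \<and>
      (\<forall>d. u \<le> d \<longrightarrow> d \<le> u + int 0 \<longrightarrow> edge \<rho> d \<in> insert (edge \<rho> u) (family_ports {}))"
      using True by simp
    then show ?thesis by blast
  next
    case False
    have "card {i\<in>A. s i mod m = u mod m} = Suc (card {i\<in>A. (s i + int (l i)) mod m = u mod m})"
      using less.prems(2) False unfolding balanced_def by (auto dest: spec[of _ "u mod m"])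
    then have "{i\<in>A. s i mod m = u mod m} \<noteq> {}" by force
    then obtain i where i: "i \<in> A" "u mod m = s i mod m" by auto
    let ?w = "s i + int (l i)"
    have "card (A - {i}) < card A" using i less.prems(1) by (meson card_Diff1_less)
    from less.hyps[OF this _ balanced_remove[OF less.prems(1) i(1) less.prems(2) i(2)]] less.prems(1)
    obtain Z n where Z: "Z \<subseteq> A - {i}" "trail ?w v Z" "balanced 0 0 (A - {i} - Z)"
      "(?w + int n) mod m = v mod m" "\<forall>d. ?w \<le> d \<longrightarrow> d \<le> ?w + int n \<longrightarrow> edge \<rho> d \<in> insert (edge \<rho> ?w) (family_ports Z)"
      by auto
    have fin: "finite Z" using Z(1) less.prems(1) by (meson finite_Diff finite_subset)
    have iZ: "i \<notin> Z" using Z(1) by blast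
    note ins = family_insert[OF fin iZ]
    have "trail u v (insert i Z)"
      unfolding trail_def ins
    proof (intro allI impI)
      fix K X R and M :: "'p multiset" assume "fills (\<rho> (v - 1)) (\<rho> v) K M X R"
      then have "fills (\<rho> (?w - 1)) (\<rho> ?w) (K + family_corners Z) (M + family_polygons Z) (X \<union> family_cells Z) (R \<union> family_ports Z)"
        by (rule trailD[OF Z(2)])
      from fills_arc[OF this, of "j i"]
      show "fills (\<rho> (u - 1)) (\<rho> u) (K + (image_mset \<rho> (mset_set {s i<..s i + int (l i)}) + family_corners Z)) (M + add_mset (j i) (family_polygons Z))
        (X \<union> ((\<lambda>d. (\<rho> d, j i)) ` {s i - 1..s i + int (l i)} \<union> family_cells Z)) (R \<union> (edge \<rho> ` {s i..s i + int (l i)} \<union> family_ports Z))"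
        using rho_cong[OF i(2)] rho_cong1[OF i(2)] by (simp add: ac_simps)
    qed
    moreover have "A - insert i Z = A - {i} - Z" by blast
    moreover have "(u + int (l i + n)) mod m = v mod m"
    proof -
      have "(u + int (l i + n)) mod m = (s i + int (l i + n)) mod m" using i(2) by (metis mod_add_left_eq)
      then show ?thesis using Z(4) by (simp add: add.assoc)
    qed
    moreover have "edge \<rho> d \<in> family_ports (insert i Z)" if d: "u \<le> d" "d \<le> u + int (l i + n)" for d
    proof -
      \<comment> \<open>The shift that moves \<open>u\<close> to the first chord of
        \<open>i\<close>; it is a multiple of \<open>m\<close>.\<close>
      let ?d = "d - u + s i"
      have "?d mod m = d mod m"
      proof -
        have "(d - u + s i) mod m = (d - u + u) mod m" using i(2) by (metis mod_add_right_eq)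
        then show ?thesis by simp
      qed
      then have ed: "edge \<rho> d = edge \<rho> ?d" by (metis edge_cong)
      have "edge \<rho> ?w \<in> family_ports (insert i Z)" unfolding ins by auto
      moreover have "edge \<rho> ?d \<in> insert (edge \<rho> ?w) (family_ports (insert i Z))"
      proof (cases "?d \<le> ?w")
        case True
        then show ?thesis unfolding ins using d by auto
      next
        case False
        then have "?w \<le> ?d" "?d \<le> ?w + int n" using d by auto
        then have "edge \<rho> ?d \<in> insert (edge \<rho> ?w) (family_ports Z)" using Z(5) by blast
        then show ?thesis unfolding ins by blast
      qed
      ultimately show ?thesis unfolding ed by (simp add: insert_absorb)
    qed
    ultimately have "insert i Z \<subseteq> A \<and> trail u v (insert i Z) \<and> balanced 0 0 (A - insert i Z) \<and>
      (u + int (l i + n)) mod m = v mod m \<and>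
      (\<forall>d. u \<le> d \<longrightarrow> d \<le> u + int (l i + n) \<longrightarrow> edge \<rho> d \<in> insert (edge \<rho> u) (family_ports (insert i Z)))"
      using Z(1,3) i(1) by (simp del: of_nat_add) blast
    then show ?thesis by blast
  qed
qed

text \<open>Without \<open>i\<close> the family is balanced for a trail from the last to the first
  chord of \<open>i\<close>; together with \<open>i\<close> this trail closes up to a cycle.\<close>

lemma insert_cycle:
  assumes "finite A" "balanced 0 0 A" "i \<in> A" "fills x y K M X R" "edge \<rho> (s i) \<in> R"
  shows "\<exists>Z\<subseteq>A. i \<in> Z \<and> balanced 0 0 (A - Z) \<and> fills x y (K + family_corners Z) (M + family_polygons Z) (X \<union> family_cells Z) (R \<union> family_ports Z)"
proof -
  have "balanced (s i) (s i) A" using assms(2) by (simp add: balanced_def)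
  from ex_trail[OF _ balanced_remove[OF assms(1,3) this refl]] assms(1)
  obtain Z where Z: "Z \<subseteq> A - {i}" "trail (s i + int (l i)) (s i) Z" "balanced 0 0 (A - {i} - Z)"
    by auto
  have fin: "finite Z" using Z(1) assms(1) by (meson finite_Diff finite_subset)
  have iZ: "i \<notin> Z" using Z(1) by blast
  note ins = family_insert[OF fin iZ]
  have "fills x y (K + family_corners (insert i Z)) (M + family_polygons (insert i Z)) (X \<union> family_cells (insert i Z)) (R \<union> family_ports (insert i Z))"
  proof (rule fills_insert_loop[of "\<rho> (s i - 1)" "\<rho> (s i)"])
    fix K X R and M :: "'p multiset" assume "fills (\<rho> (s i - 1)) (\<rho> (s i)) K M X R"
    then have "fills (\<rho> (s i + int (l i) - 1)) (\<rho> (s i + int (l i))) (K + family_corners Z) (M + family_polygons Z) (X \<union> family_cells Z) (R \<union> family_ports Z)"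
      by (rule trailD[OF Z(2)])
    from fills_arc[OF this, of "j i"]
    show "fills (\<rho> (s i - 1)) (\<rho> (s i)) (K + family_corners (insert i Z)) (M + family_polygons (insert i Z)) (X \<union> family_cells (insert i Z)) (R \<union> family_ports (insert i Z))"
      unfolding ins by (simp add: ac_simps)
  qed (use assms(4,5) in \<open>auto simp: edge_def\<close>)
  moreover have "A - insert i Z = A - {i} - Z" by blast
  moreover have "insert i Z \<subseteq> A" using Z(1) assms(3) by blast
  ultimately show ?thesis using Z(3) by (intro exI[of _ "insert i Z"] conjI) simp_all
qed

lemma insert_balanced:
  assumes "finite A" "balanced 0 0 A" "fills x y K M X R" "\<And>d. edge \<rho> d \<in> R"
  shows "\<exists>R'. fills x y (K + family_corners A) (M + family_polygons A) (X \<union> family_cells A) R'"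
  using assms
proof (induction "card A" arbitrary: A K M X R rule: less_induct)
  case less
  show ?case
  proof (cases "A = {}")
    case True
    show ?thesis by (rule exI[of _ R]) (use True less.prems(3) in \<open>simp add: family_empty\<close>)
  next
    case False
    then obtain i where "i \<in> A" by blast
    from insert_cycle[OF less.prems(1,2) this less.prems(3,4)]
    obtain Z where Z: "Z \<subseteq> A" "i \<in> Z" "balanced 0 0 (A - Z)"
      "fills x y (K + family_corners Z) (M + family_polygons Z) (X \<union> family_cells Z) (R \<union> family_ports Z)"
      by (elim exE conjE) (rule that; assumption)
    have "card (A - Z) < card A" using Z(1,2) less.prems(1) by (intro psubset_card_mono) auto
    moreover have "edge \<rho> d \<in> R \<union> family_ports Z" for d using less.prems(4) by blast
    ultimately have "\<exists>R'. fills x y (K + family_corners Z + family_corners (A - Z)) (M + family_polygons Z + family_polygons (A - Z)) (X \<union> family_cells Z \<union> family_cells (A - Z)) R'"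
      using less.prems(1) by (intro less.hyps[OF _ _ Z(3,4)]) auto
    then show ?thesis unfolding family_union[OF less.prems(1) Z(1)] by (simp add: add.assoc Un_assoc)
  qed
qed

text \<open>
  The trail from chord 2 to chord 0 passes all chords except possibly chord 1, which is a side or a chord of
  polygon \<open>i\<^sub>0\<close>. So every cycle of the remaining polygons can be inserted somewhere.
\<close>

lemma fills_family:
  assumes fin: "finite A" and bal: "balanced 2 0 A" and i0: "i0 \<in> A" "2 \<le> s i0" "s i0 \<le> m" "m < s i0 + int (l i0)"
  shows "\<exists>R. fills (\<rho> 1) (\<rho> 2) (family_corners A) (family_polygons A) (family_cells A) R"
proof -
  from ex_trail[OF fin bal] obtain Z n where Z: "Z \<subseteq> A" "trail 2 0 Z" "balanced 0 0 (A - Z)"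
    "(2 + int n) mod m = 0 mod m" "\<forall>d. 2 \<le> d \<longrightarrow> d \<le> 2 + int n \<longrightarrow> edge \<rho> d \<in> insert (edge \<rho> 2) (family_ports Z)"
    by (elim exE conjE) (rule that; assumption)
  have "fills (\<rho> (2 - 1)) (\<rho> 2) ({#} + family_corners Z) ({#} + family_polygons Z) ({} \<union> family_cells Z) ({{\<rho> (0 - 1), \<rho> 0}} \<union> family_ports Z)"
    by (rule trailD[OF Z(2) fills_Side])
  then have f0: "\<exists>R. family_ports Z \<subseteq> R \<and> fills (\<rho> 1) (\<rho> 2) (family_corners Z) (family_polygons Z) (family_cells Z) R"
    by (intro exI[of _ "{{\<rho> (0 - 1), \<rho> 0}} \<union> family_ports Z"] conjI Un_upper2) simp
  have "\<exists>R. insert (edge \<rho> 2) (family_ports Z) \<subseteq> R \<and> fills (\<rho> 1) (\<rho> 2) (family_corners Z) (family_polygons Z) (family_cells Z) R"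
  proof -
    obtain R where R: "family_ports Z \<subseteq> R" "fills (\<rho> 1) (\<rho> 2) (family_corners Z) (family_polygons Z) (family_cells Z) R" using f0 by blast
    then obtain t where t: "chordal t" "corners t = family_corners Z" "polygons t = family_polygons Z" "\<And>e. family_cells Z \<subseteq> cells e (\<rho> 1) (\<rho> 2) t" "R \<subseteq> ports (\<rho> 1) (\<rho> 2) t"
      unfolding fills_def by blast
    have "edge \<rho> 2 \<in> ports (\<rho> 1) (\<rho> 2) t" using t(1) by (cases t) (auto simp: edge_def)
    then have "fills (\<rho> 1) (\<rho> 2) (family_corners Z) (family_polygons Z) (family_cells Z) (insert (edge \<rho> 2) R)"
      using t by (intro fillsI[of t]) auto
    then show ?thesis using R(1) by (intro exI[of _ "insert (edge \<rho> 2) R"]) blast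
  qed
  then obtain R where R: "insert (edge \<rho> 2) (family_ports Z) \<subseteq> R" "fills (\<rho> 1) (\<rho> 2) (family_corners Z) (family_polygons Z) (family_cells Z) R" by blast
  \<comment> \<open>The unwrapped trail ends at a multiple of \<open>m\<close> that is at least 2,
    hence at \<open>m\<close> or beyond.\<close>
  have "m dvd 2 + int n" using Z(4) by presburger
  then have n: "m \<le> 2 + int n" by (intro zdvd_imp_le) auto
  have e2m: "edge \<rho> d \<in> R" if "2 \<le> d" "d \<le> m" for d using Z(5) R(1) n that by auto
  have every: "edge \<rho> d \<in> S" if S: "\<And>d. 2 \<le> d \<Longrightarrow> d \<le> m + 1 \<Longrightarrow> edge \<rho> d \<in> S" for S d
  proof -
    let ?d = "2 + (d - 2) mod m"
    have "?d mod m = d mod m" by (simp add: mod_add_right_eq)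
    then have "edge \<rho> d = edge \<rho> ?d" by (metis edge_cong)
    moreover have "2 \<le> ?d" "?d \<le> m + 1" using m2 pos_mod_bound[of m "d - 2"] pos_mod_sign[of m "d - 2"] by linarith+
    ultimately show ?thesis using S[of ?d] by simp
  qed
  \<comment> \<open>Chord \<open>m + 1\<close> has the labels of chord 1. Polygon \<open>i0\<close>
    begins at a chord from 2 to \<open>m\<close>, where it can be inserted, and it contains chord
    \<open>m + 1\<close>.\<close>
  have em: "edge \<rho> (m + 1) \<in> family_ports Y" if "i0 \<in> Y" for Y
    using that i0 unfolding family_ports_def by force
  have "\<exists>Y S. Y \<subseteq> A \<and> balanced 0 0 (A - Y) \<and> fills (\<rho> 1) (\<rho> 2) (family_corners Y) (family_polygons Y) (family_cells Y) S \<and> (\<forall>d. edge \<rho> d \<in> S)"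
  proof (cases "i0 \<in> Z")
    case True
    then have "edge \<rho> (m + 1) \<in> R" using em[OF True] R(1) by blast
    have "edge \<rho> d \<in> R" for d
    proof (rule every)
      fix d assume "2 \<le> d" "d \<le> m + 1"
      then show "edge \<rho> d \<in> R" using e2m[of d] \<open>edge \<rho> (m + 1) \<in> R\<close> by (cases "d = m + 1") auto
    qed
    then show ?thesis using Z(1,3) R(2) by (intro exI[of _ Z] exI[of _ R]) simp
  next
    case False
    then have "i0 \<in> A - Z" using i0 by blast
    have "finite (A - Z)" using fin by simp
    from insert_cycle[OF this Z(3) \<open>i0 \<in> A - Z\<close> R(2) e2m[OF i0(2,3)]]
    obtain Y where Y: "Y \<subseteq> A - Z" "i0 \<in> Y" "balanced 0 0 (A - Z - Y)"
      "fills (\<rho> 1) (\<rho> 2) (family_corners Z + family_corners Y) (family_polygons Z + family_polygons Y) (family_cells Z \<union> family_cells Y) (R \<union> family_ports Y)"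
      by (elim exE conjE) (rule that; assumption)
    have "edge \<rho> d \<in> R \<union> family_ports Y" for d
    proof (rule every)
      fix d assume "2 \<le> d" "d \<le> m + 1"
      then show "edge \<rho> d \<in> R \<union> family_ports Y" using e2m[of d] em[OF Y(2)] by (cases "d = m + 1") auto
    qed
    moreover have "family_corners (Z \<union> Y) = family_corners Z + family_corners Y" "family_polygons (Z \<union> Y) = family_polygons Z + family_polygons Y" "family_cells (Z \<union> Y) = family_cells Z \<union> family_cells Y"
    proof -
      have "finite (Z \<union> Y)" "Z \<subseteq> Z \<union> Y" "Z \<union> Y - Z = Y" using Z(1) Y(1) fin by (auto intro: finite_subset)
      then show "family_corners (Z \<union> Y) = family_corners Z + family_corners Y" "family_polygons (Z \<union> Y) = family_polygons Z + family_polygons Y" "family_cells (Z \<union> Y) = family_cells Z \<union> family_cells Y"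
        using family_union[of "Z \<union> Y" Z] by auto
    qed
    moreover have "A - Z - Y = A - (Z \<union> Y)" by blast
    moreover have "Z \<union> Y \<subseteq> A" using Y(1) Z(1) by blast
    ultimately show ?thesis using Y(3,4)
      by (intro exI[of _ "Z \<union> Y"] exI[of _ "R \<union> family_ports Y"] conjI) simp_all
  qed
  then obtain Y S where Y: "Y \<subseteq> A" "balanced 0 0 (A - Y)" "fills (\<rho> 1) (\<rho> 2) (family_corners Y) (family_polygons Y) (family_cells Y) S" "\<forall>d. edge \<rho> d \<in> S"
    by (elim exE conjE) (rule that; assumption)
  have "\<exists>R. fills (\<rho> 1) (\<rho> 2) (family_corners Y + family_corners (A - Y)) (family_polygons Y + family_polygons (A - Y)) (family_cells Y \<union> family_cells (A - Y)) R"
    by (rule insert_balanced[OF _ Y(2,3)]) (use fin Y(4) in auto)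
  then show ?thesis unfolding family_union[OF fin Y(1)] .
qed

end

section \<open>The polygons\<close>

text \<open>If items are numbered in order of position and \<open>g y\<close> is the number of the
  first one beyond position \<open>y\<close>, then \<open>S P\<close> is the position of item
  \<open>P\<close>, the least \<open>y\<close> with \<open>P < g y\<close>. It exists because a
  periodic increment makes \<open>g\<close> unbounded in both directions.\<close>

lemma ex_inverse:
  fixes g :: "int \<Rightarrow> int"
  assumes mono: "mono g" and per: "\<And>y. g (y + m) = g y + M" and "0 < m" "0 < M"
  shows "\<exists>S. (\<forall>P y. S P \<le> y \<longleftrightarrow> P < g y) \<and> (\<forall>P. S (P + M) = S P + m)"
proof -
  have mult: "g (int k * m) = g 0 + int k * M" "g (- int k * m) = g 0 - int k * M" for k
  proof -
    show "g (int k * m) = g 0 + int k * M" 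
    proof (induction k)
      case (Suc k) then show ?case using per[of "int k * m"] by (simp add: algebra_simps)
    qed simp
    show "g (- int k * m) = g 0 - int k * M" 
    proof (induction k)
      case (Suc k) then show ?case using per[of "- int (Suc k) * m"] by (simp add: algebra_simps)
    qed simp
  qed
  have "\<exists>y. \<forall>z. y \<le> z \<longleftrightarrow> P < g z" for P
  proof -
    \<comment> \<open>Large enough for \<open>P\<close> to lie between the values of
      \<open>g\<close> at \<open>- k * m\<close> and \<open>k * m\<close>.\<close>
    define k where "k = nat (\<bar>P\<bar> + \<bar>g 0\<bar> + 1)"
    have "int k * 1 \<le> int k * M" using assms(4) by (intro mult_left_mono) auto
    then have kM: "\<bar>P\<bar> + \<bar>g 0\<bar> + 1 \<le> int k * M" by (simp add: k_def)
    define y0 where "y0 = - int k * m"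
    have lo: "\<not> P < g y0" using mult(2)[of k] kM by (simp add: y0_def)
    have "P < g (int k * m)" using mult(1)[of k] kM by linarith
    moreover have "int k * m = y0 + int (nat (2 * int k * m))" using assms(3) by (simp add: y0_def)
    ultimately have ex: "\<exists>n. P < g (y0 + int n)" by metis
    define n where "n = (LEAST n. P < g (y0 + int n))"
    have n: "P < g (y0 + int n)" unfolding n_def using ex by (rule LeastI_ex)
    have "y0 + int n \<le> z \<longleftrightarrow> P < g z" for z
    proof
      assume "y0 + int n \<le> z"
      then show "P < g z" using n monoD[OF mono] by (meson less_le_trans)
    next
      assume z: "P < g z"
      have "y0 \<le> z" using lo z monoD[OF mono, of z y0] by linarith
      then have "z = y0 + int (nat (z - y0))" by simp
      then have "n \<le> nat (z - y0)" unfolding n_def using z by (metis Least_le)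
      then show "y0 + int n \<le> z" using \<open>y0 \<le> z\<close> by linarith
    qed
    then show ?thesis by blast
  qed
  then obtain S where S: "\<And>P z. S P \<le> z \<longleftrightarrow> P < g z" by metis
  have "S (P + M) = S P + m" for P
  proof -
    have "S (P + M) \<le> z \<longleftrightarrow> S P + m \<le> z" for z
    proof -
      have "S (P + M) \<le> z \<longleftrightarrow> P + M < g (z - m + m)" using S by simp
      also have "\<dots> \<longleftrightarrow> P < g (z - m)" unfolding per by simp
      also have "\<dots> \<longleftrightarrow> S P \<le> z - m" using S by simp
      finally show ?thesis by linarith
    qed
    then show ?thesis by (meson order_antisym order_refl)
  qed
  then show ?thesis using S by blast
qed

section \<open>Counting over one period\<close>

lemma shift_multiple:
  fixes Q :: "int \<Rightarrow> int \<Rightarrow> bool"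
  assumes "\<And>P y. Q (P + M) (y + m) \<longleftrightarrow> Q P y"
  shows "Q (P + k * M) (y + k * m) \<longleftrightarrow> Q P y"
proof -
  have *: "Q (P + int n * M) (y + int n * m) \<longleftrightarrow> Q P y" for n P y
  proof (induction n)
    case (Suc n)
    then show ?case using assms[of "P + int n * M" "y + int n * m"] by (simp add: algebra_simps)
  qed simp
  show ?thesis
  proof (cases "0 \<le> k")
    case True
    then show ?thesis using *[of P "nat k" y] by simp
  next
    case False
    then show ?thesis using *[of "P + k * M" "nat (- k)" "y + k * m"] by (simp add: algebra_simps)
  qed
qed

text \<open>A unique multiple of \<open>(M, m)\<close> shifts a pair \<open>(i, d)\<close> with
  \<open>d\<close> congruent to \<open>c\<close> to a pair \<open>(P, c)\<close>, and a unique one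
  leads back to an index in \<open>{0..<M}\<close>. So counts over one period of polygons become
  counts of integers at a fixed place.\<close>

lemma card_unwrap:
  fixes Q :: "int \<Rightarrow> int \<Rightarrow> bool"
  assumes Q: "\<And>P y. Q (P + M) (y + m) \<longleftrightarrow> Q P y" and "0 < m" "0 < M"
  shows "card {(i, d). i \<in> {0..<M} \<and> Q i d \<and> d mod m = c mod m} = card {P. Q P c}"
proof (rule bij_betw_same_card, rule bij_betw_byWitness)
  let ?f = "\<lambda>(i, d). i + (c - d) div m * M" and ?g = "\<lambda>P. (P mod M, c - P div M * m)"
  show "\<forall>a\<in>{(i, d). i \<in> {0..<M} \<and> Q i d \<and> d mod m = c mod m}. ?g (?f a) = a"
  proof
    fix a assume "a \<in> {(i, d). i \<in> {0..<M} \<and> Q i d \<and> d mod m = c mod m}"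
    then obtain i d where a: "a = (i, d)" "i \<in> {0..<M}" "d mod m = c mod m" by blast
    have "m dvd c - d" using a(3) by (metis mod_eq_dvd_iff)
    then have "(c - d) div m * m = c - d" by simp
    then show "?g (?f a) = a" using a(1,2) assms(3) by simp
  qed
  show "\<forall>P\<in>{P. Q P c}. ?f (?g P) = P"
  proof
    fix P
    have "(c - (c - P div M * m)) div m = P div M" using assms(2) by simp
    then show "?f (?g P) = P" by simp
  qed
  show "?f ` {(i, d). i \<in> {0..<M} \<and> Q i d \<and> d mod m = c mod m} \<subseteq> {P. Q P c}"
  proof
    fix P assume "P \<in> ?f ` {(i, d). i \<in> {0..<M} \<and> Q i d \<and> d mod m = c mod m}"
    then obtain i d where P: "P = i + (c - d) div m * M" "Q i d" "d mod m = c mod m" by auto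
    have "m dvd c - d" using P(3) by (metis mod_eq_dvd_iff)
    then have "d + (c - d) div m * m = c" by simp
    then show "P \<in> {P. Q P c}" using shift_multiple[of Q M m i "(c - d) div m" d, OF Q] P(1,2) by simp
  qed
  show "?g ` {P. Q P c} \<subseteq> {(i, d). i \<in> {0..<M} \<and> Q i d \<and> d mod m = c mod m}"
  proof
    fix a assume "a \<in> ?g ` {P. Q P c}"
    then obtain P where P: "a = ?g P" "Q P c" by blast
    have "P = P mod M + P div M * M" "c = (c - P div M * m) + P div M * m" by simp_all
    then have "Q (P mod M) (c - P div M * m)"
      using P(2) shift_multiple[of Q M m "P mod M" "P div M" "c - P div M * m", OF Q] by simp
    moreover have "(c - P div M * m) mod m = c mod m" by (simp add: mod_diff_eq[symmetric])
    moreover have "P mod M \<in> {0..<M}" using assms(3) by simp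
    ultimately show "a \<in> {(i, d). i \<in> {0..<M} \<and> Q i d \<and> d mod m = c mod m}" using P(1) by simp
  qed
qed

lemma card_unwrap_fun:
  fixes f :: "int \<Rightarrow> int"
  assumes f: "\<And>P. f (P + M) = f P + m" and "0 < m" "0 < M"
  shows "card {i \<in> {0..<M}. f i mod m = c mod m} = card {P. f P = c}"
proof -
  have "bij_betw (\<lambda>i. (i, f i)) {i \<in> {0..<M}. f i mod m = c mod m} {(i, d). i \<in> {0..<M} \<and> d = f i \<and> d mod m = c mod m}"
    by (rule bij_betw_byWitness[where f' = fst]) auto
  then have "card {i \<in> {0..<M}. f i mod m = c mod m} = card {(i, d). i \<in> {0..<M} \<and> d = f i \<and> d mod m = c mod m}"
    by (rule bij_betw_same_card)
  also have "\<dots> = card {P. c = f P}"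
    by (rule card_unwrap) (use assms in auto)
  finally show ?thesis by (simp add: eq_commute)
qed

lemma div_diff_1:
  fixes x m :: int
  assumes "0 < m"
  shows "x div m - (x - 1) div m = of_bool (x mod m = 0)"
proof (cases "x mod m = 0")
  case True
  then have x: "x = (x div m) * m" using assms by (metis add.right_neutral div_mult_mod_eq)
  have "(x - 1) div m = ((m - 1) + (x div m - 1) * m) div m"
    by (rule arg_cong[of _ _ "\<lambda>z. z div m"], subst x) (simp add: algebra_simps)
  also have "\<dots> = x div m - 1" using assms by (subst div_mult_self1) (auto simp: div_pos_pos_trivial)
  finally show ?thesis using True by simp
next
  case False
  have "(x - 1) div m = ((x mod m - 1) + (x div m) * m) div m" by (simp add: algebra_simps)
  also have "\<dots> = x div m + (x mod m - 1) div m" using assms by (intro div_mult_self1) simp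
  also have "(x mod m - 1) div m = 0"
    using False pos_mod_sign[OF assms, of x] pos_mod_bound[OF assms, of x] by (intro div_pos_pos_trivial) linarith+
  finally have "(x - 1) div m = x div m" by simp
  then show ?thesis using False by simp
qed

text \<open>
  \<open>E y\<close> is the number of chords up to \<open>y\<close>. The polygons with first chord at most \<open>y\<close> are counted by \<open>cS\<close>, and those with
  last chord at most \<open>y\<close> by \<open>cT\<close>: every chord is the first chord of one polygon and the last one of another, the trail begins
  at chord 2 and ends at chord 0. \<open>S\<close> and \<open>T\<close> enumerate the first and last chords; they are
  unwrapped to all integers, and the offset \<open>t - 1\<close> lets exactly \<open>t\<close> polygons pass over a chord.
\<close>

lemma ex_dissection:
  fixes m p t :: int
  assumes m: "2 \<le> m" and p: "1 \<le> p" and t: "2 \<le> t" and bound: "m * p + 2 \<le> t * m + 2 * (t * p)"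
  shows "\<exists>d. chordal d \<and> set_mset (corners d) \<subseteq> {0..<m} \<and> set_mset (polygons d) \<subseteq> {0..<p} \<and>
    (\<forall>z\<in>{0..<m}. int (count (add_mset (1 mod m) (add_mset (2 mod m) (corners d))) z) \<le> t) \<and>
    (\<forall>q\<in>{0..<p}. int (count (polygons d) q) \<le> t) \<and> {0..<m} \<times> {0..<p} \<subseteq> cells undefined (1 mod m) (2 mod m) d"
proof -
  define N where "N = t * p - 1"
  define M where "M = t * p"
  define E where "E y = (N * y) div m" for y
  \<comment> \<open>The chords 2 and 0 for the ends of the trail have two effects. The quotients in
    \<open>cS (c + 1)\<close> and \<open>cT (c - 1)\<close> agree, so the ends cancel in
    \<open>cover\<close>. And the corners 1 and 2 get one occurrence less in \<open>corner\<close>,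
    which makes room for the two ends of the outermost chord.\<close>
  define cS where "cS y = E y + (y - 2) div m + 1" for y
  define cT where "cT y = E y + y div m" for y
  have m0: "0 < m" using m by simp
  have "2 * 1 \<le> t * p" using p t by (intro mult_mono) auto
  then have N0: "0 \<le> N" and M0: "0 < M" by (auto simp: N_def M_def)
  have Emono: "E x \<le> E y" if "x \<le> y" for x y
    unfolding E_def using that N0 m0 by (intro zdiv_mono1 mult_left_mono) auto
  have Eper: "E (y + m) = E y + N" for y unfolding E_def using m0 by (simp add: distrib_left)
  have "mono cS" "mono cT"
    unfolding cS_def cT_def using Emono m0 by (auto intro!: monoI add_mono zdiv_mono1)
  have dm: "(y + m) div m = y div m + 1" for y using m0 by simp
  have dm2: "(y + m - 2) div m = (y - 2) div m + 1" for y using dm[of "y - 2"] by (simp add: algebra_simps)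
  have cSper: "cS (y + m) = cS y + M" for y
    unfolding cS_def Eper dm2 by (simp add: N_def M_def)
  have cTper: "cT (y + m) = cT y + M" for y
    unfolding cT_def Eper dm by (simp add: N_def M_def)
  obtain S where S: "\<And>P y. S P \<le> y \<longleftrightarrow> P < cS y" and Sper: "\<And>P. S (P + M) = S P + m"
    using ex_inverse[OF \<open>mono cS\<close> cSper m0 M0] by blast
  obtain T where T: "\<And>P y. T P \<le> y \<longleftrightarrow> P < cT y" and Tper: "\<And>P. T (P + M) = T P + m"
    using ex_inverse[OF \<open>mono cT\<close> cTper m0 M0] by blast
  define e where "e i = T (i + t - 1)" for i
  have eper: "e (P + M) = e P + m" for P
    using Tper[of "P + t - 1"] by (simp add: e_def algebra_simps)
  have e_iff: "e P \<le> y \<longleftrightarrow> P + t - 1 < cT y" for P y unfolding e_def by (rule T)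
  have le: "S i \<le> e i" for i
  proof -
    have "i + t - 1 < cT (e i)" using e_iff[of i "e i"] by simp
    moreover have "e i div m \<le> (e i - 2) div m + 1"
      using dm[of "e i - 2"] zdiv_mono1[of "e i" "e i - 2 + m" m] m by simp
    ultimately have "i < cS (e i)" using t by (simp add: cS_def cT_def)
    then show ?thesis using S by blast
  qed
  define l where "l i = nat (e i - S i)" for i
  have ends: "S i + int (l i) = e i" for i using le[of i] by (simp add: l_def)
  define A where "A = {0..<M}"
  interpret polygon_family m "\<lambda>d. d mod m" S l "\<lambda>i. i mod p"
    by unfold_locales (use m in simp_all)
  have Sset: "{P. S P = c} = {cS (c - 1)..<cS c}" for c
  proof (rule set_eqI)
    fix P
    have "S P = c \<longleftrightarrow> S P \<le> c \<and> \<not> S P \<le> c - 1" by linarith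
    also have "\<dots> \<longleftrightarrow> P \<in> {cS (c - 1)..<cS c}" unfolding S by auto
    finally show "P \<in> {P. S P = c} \<longleftrightarrow> P \<in> {cS (c - 1)..<cS c}" by simp
  qed
  have eset: "{P. e P = c} = {cT (c - 1) - t + 1..<cT c - t + 1}" for c
  proof (rule set_eqI)
    fix P
    have "e P = c \<longleftrightarrow> e P \<le> c \<and> \<not> e P \<le> c - 1" by linarith
    also have "\<dots> \<longleftrightarrow> P \<in> {cT (c - 1) - t + 1..<cT c - t + 1}" unfolding e_iff by auto
    finally show "P \<in> {P. e P = c} \<longleftrightarrow> P \<in> {cT (c - 1) - t + 1..<cT c - t + 1}" by simp
  qed
  have "balanced 2 0 A"
    unfolding balanced_def
  proof
    fix c
    show "card {i \<in> A. S i mod m = c} + of_bool (c = 0 mod m) = card {i \<in> A. (S i + int (l i)) mod m = c} + of_bool (c = 2 mod m)"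
    proof (cases "c mod m = c")
      case True
      have "card {i \<in> A. S i mod m = c} = nat (cS c - cS (c - 1))"
        using card_unwrap_fun[of S M m c, OF Sper m0 M0] True by (simp add: A_def Sset)
      moreover have "card {i \<in> A. (S i + int (l i)) mod m = c} = nat (cT c - cT (c - 1))"
        using card_unwrap_fun[of e M m c, OF eper m0 M0] True by (simp add: A_def ends eset)
      moreover have "cS c - cS (c - 1) = E c - E (c - 1) + of_bool (c = 2 mod m)"
      proof -
        have "(c - 2) mod m = 0 \<longleftrightarrow> c = 2 mod m"
          using True by (metis mod_eq_dvd_iff mod_0_imp_dvd dvd_imp_mod_0)
        then show ?thesis using div_diff_1[OF m0, of "c - 2"] by (simp add: cS_def algebra_simps)
      qed
      moreover have "cT c - cT (c - 1) = E c - E (c - 1) + of_bool (c = 0 mod m)"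
        using div_diff_1[OF m0, of c] True by (simp add: cT_def)
      moreover have "E (c - 1) \<le> E c" by (rule Emono) simp
      ultimately show ?thesis by (auto simp: nat_add_distrib)
    next
      case False
      then have "{i \<in> A. S i mod m = c} = {}" "{i \<in> A. (S i + int (l i)) mod m = c} = {}" "c \<noteq> 0 mod m" "c \<noteq> 2 mod m"
        by auto
      then show ?thesis by (simp only: card.empty of_bool_eq)
    qed
  qed
  have "\<exists>R. fills (1 mod m) (2 mod m) (family_corners A) (family_polygons A) (family_cells A) R"
  \<comment> \<open>The last polygon of the period begins at a chord from 2 to \<open>m\<close> and,
    because of \<open>t \<ge> 2\<close>, ends beyond chord \<open>m\<close>.\<close>
  proof (rule fills_family[of A "M - 1"])
    show "balanced 2 0 A" by fact
    show "finite A" "M - 1 \<in> A" using M0 by (auto simp: A_def)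
    have "E m = N" using Eper[of 0] by (simp add: E_def)
    then show "S (M - 1) \<le> m" unfolding S using m by (simp add: cS_def M_def N_def div_pos_pos_trivial)
    have "E 1 \<le> N" using Emono[of 1 m] \<open>E m = N\<close> m by simp
    moreover have "(- 1) div m = - 1" using m0 by (rule div_eq_minus1)
    ultimately have "\<not> S (M - 1) \<le> 1" unfolding S by (simp add: cS_def M_def N_def)
    then show "2 \<le> S (M - 1)" by simp
    have "\<not> e (M - 1) \<le> m" unfolding e_iff using \<open>E m = N\<close> t m0 by (simp add: cT_def M_def N_def)
    then show "m < S (M - 1) + int (l (M - 1))" unfolding ends by simp
  qed
  then obtain d where d: "chordal d" "corners d = family_corners A" "polygons d = family_polygons A" "family_cells A \<subseteq> cells undefined (1 mod m) (2 mod m) d"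
    unfolding fills_def by blast
  have corner: "int (count (add_mset (1 mod m) (add_mset (2 mod m) (corners d))) z) \<le> t" if z: "z \<in> {0..<m}" for z
  proof -
    have zm: "z mod m = z" using z by simp
    \<comment> \<open>Corner \<open>y\<close> is one of those that polygon \<open>P\<close> adds to
      the two ends of its first chord.\<close>
    let ?Q = "\<lambda>P y. S P < y \<and> y \<le> e P"
    have "count (family_corners A) z = (\<Sum>i\<in>A. count (image_mset (\<lambda>d. d mod m) (mset_set {S i<..e i})) z)"
      unfolding family_corners_def ends by (simp add: count_sum)
    also have "\<dots> = (\<Sum>i\<in>A. card {d \<in> {S i<..e i}. d mod m = z})"
    proof (rule sum.cong[OF refl])
      fix i
      have "count (image_mset (\<lambda>d. d mod m) (mset_set {S i<..e i})) z = (\<Sum>x | x \<in> {S i<..e i} \<and> x mod m = z. 1)"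
        by (simp add: count_image_mset' eq_commute)
      then show "count (image_mset (\<lambda>d. d mod m) (mset_set {S i<..e i})) z = card {d \<in> {S i<..e i}. d mod m = z}" by simp
    qed
    also have "\<dots> = card (SIGMA i:A. {d \<in> {S i<..e i}. d mod m = z})"
    proof (rule card_SigmaI[symmetric])
      have "finite {d \<in> {S i<..e i}. d mod m = z}" for i
        by (rule finite_subset[of _ "{S i<..e i}"]) auto
      then show "\<forall>i\<in>A. finite {d \<in> {S i<..e i}. d mod m = z}" by blast
    qed (simp add: A_def)
    also have "(SIGMA i:A. {d \<in> {S i<..e i}. d mod m = z}) = {(i, d). i \<in> {0..<M} \<and> ?Q i d \<and> d mod m = z mod m}"
      unfolding zm A_def by auto
    also have "card \<dots> = card {P. ?Q P z}"
      by (rule card_unwrap) (use Sper eper m0 M0 in auto)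
    also have "{P. ?Q P z} = {cT (z - 1) - t + 1..<cS (z - 1)}"
    proof (rule set_eqI)
      fix P
      have "?Q P z \<longleftrightarrow> S P \<le> z - 1 \<and> \<not> e P \<le> z - 1" by linarith
      also have "\<dots> \<longleftrightarrow> P \<in> {cT (z - 1) - t + 1..<cS (z - 1)}" unfolding S e_iff by auto
      finally show "P \<in> {P. ?Q P z} \<longleftrightarrow> P \<in> {cT (z - 1) - t + 1..<cS (z - 1)}" by simp
    qed
    finally have "count (family_corners A) z = nat (cS (z - 1) - cT (z - 1) + t - 1)" by (simp add: algebra_simps)
    also have "cS (z - 1) - cT (z - 1) + t - 1 = t - of_bool (z = 1 mod m) - of_bool (z = 2 mod m)"
    proof -
      have "(z - 1) mod m = 0 \<longleftrightarrow> z = 1 mod m" "(z - 2) mod m = 0 \<longleftrightarrow> z = 2 mod m"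
        using zm by (metis mod_eq_dvd_iff mod_0_imp_dvd dvd_imp_mod_0)+
      then show ?thesis using div_diff_1[OF m0, of "z - 1"] div_diff_1[OF m0, of "z - 2"]
        by (simp add: cS_def cT_def algebra_simps)
    qed
    finally show ?thesis unfolding d(2) using t by (auto simp: of_bool_def)
  qed
  have polygon: "int (count (polygons d) q) \<le> t" if q: "q \<in> {0..<p}" for q
  proof -
    have qp: "q mod p = q" using q by simp
    have "count (polygons d) q = (\<Sum>x | x \<in> A \<and> x mod p = q. 1)"
      unfolding d(3) family_polygons_def using M0 by (simp add: count_image_mset' A_def eq_commute)
    then have "count (polygons d) q = card {x \<in> {0..<M}. x mod p = q}" by (simp add: A_def)
    also have "\<dots> \<le> card ((\<lambda>k. k * p + q) ` {0..<t})"
    proof (rule card_mono)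
      show "{x \<in> {0..<M}. x mod p = q} \<subseteq> (\<lambda>k. k * p + q) ` {0..<t}"
      proof safe
        fix x assume x: "x \<in> {0..<M}" "q = x mod p"
        have "x div p * p \<le> x" using div_mult_mod_eq[of x p] pos_mod_sign[of p x] p by linarith
        then have "x div p * p < t * p" using x by (simp add: M_def)
        then have "x div p < t" using p mult_right_less_imp_less[of "x div p" p t] by simp
        moreover have "0 \<le> x div p" using x p by (simp add: pos_imp_zdiv_nonneg_iff)
        moreover have "x = x div p * p + x mod p" by simp
        ultimately show "x \<in> (\<lambda>k. k * p + x mod p) ` {0..<t}" by (intro image_eqI[of _ _ "x div p"]) auto
      qed
    qed simp
    also have "\<dots> \<le> card {0..<t}" by (rule card_image_le) simp
    finally show ?thesis using t by simp
  qed
  have cover: "(c, q) \<in> family_cells A" if c: "c \<in> {0..<m}" and q: "q \<in> {0..<p}" for c q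
  proof -
    \<comment> \<open>First and last chords are both monotone in the index, so the polygons at
      corner \<open>c\<close> form a block; it starts at \<open>a\<close>, the first polygon whose
      last chord is at least \<open>c\<close>. \<open>P\<close> is the one labelled \<open>q\<close>
      among the first \<open>p\<close> polygons of the block.\<close>
    define a where "a = cT (c - 1) - t + 1"
    define P where "P = a + (q - a) mod p"
    \<comment> \<open>The difference \<open>E (c + 1) - E (c - 1)\<close> counts the chords numbered
      \<open>c\<close> and \<open>c + 1\<close>, which are those at corner \<open>c\<close>;
      \<open>bound\<close> makes it at least \<open>p - t\<close>.\<close>
    have "E (c - 1) + (p - t) \<le> E (c + 1)"
    proof -
      have "E (c - 1) + (p - t) = (N * (c - 1) + (p - t) * m) div m" unfolding E_def using m0 by simp
      also have "\<dots> \<le> E (c + 1)" unfolding E_def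
        using bound m0 by (intro zdiv_mono1) (auto simp: N_def algebra_simps)
      finally show ?thesis .
    qed
    then have "a + p \<le> cS (c + 1)" by (simp add: a_def cS_def cT_def)
    moreover have "a \<le> P" "P < a + p" using p by (auto simp: P_def)
    ultimately have P1: "S P \<le> c + 1" "\<not> e P \<le> c - 1" unfolding S e_iff by (auto simp: a_def)
    have Pq: "P mod p = q" using q by (simp add: P_def mod_add_right_eq)
    \<comment> \<open>Back to the representative in one period; the label stays the same because
      \<open>M\<close> is a multiple of \<open>p\<close>.\<close>
    define i where "i = P mod M"
    define k where "k = P div M"
    have iA: "i \<in> A" using M0 by (simp add: A_def i_def)
    have Pik: "P = i + k * M" by (simp add: i_def k_def)
    have "S (i + k * M) \<le> (c - k * m + k * m) + 1 \<and> c - k * m + k * m \<le> e (i + k * M)" using P1 Pik by simp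
    then have "S i \<le> c - k * m + 1 \<and> c - k * m \<le> e i"
      by (subst (asm) shift_multiple[of "\<lambda>P y. S P \<le> y + 1 \<and> y \<le> e P"]) (simp_all add: Sper eper)
    moreover have "i mod p = q" using Pq unfolding Pik M_def by (metis mod_mult_self1 mult.assoc mult.commute)
    moreover have "(c - k * m) mod m = c" using c by (simp add: mod_diff_eq[symmetric])
    ultimately have "(c, q) \<in> (\<lambda>d. (d mod m, i mod p)) ` {S i - 1..S i + int (l i)}"
      unfolding ends by (intro image_eqI[of _ _ "c - k * m"]) auto
    then show ?thesis unfolding family_cells_def using iA by blast
  qed
  have "{0..<m} \<times> {0..<p} \<subseteq> family_cells A" using cover by auto
  moreover have "set_mset (corners d) \<subseteq> {0..<m}"
    unfolding d(2) family_corners_def using m0 by (auto simp: set_mset_sum A_def)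
  moreover have "set_mset (polygons d) \<subseteq> {0..<p}"
    unfolding d(3) family_polygons_def using p by auto
  ultimately show ?thesis using d(1,4) corner polygon by (intro exI[of _ d] conjI ballI) (assumption | erule subset_trans)+
qed

section \<open>The bar visibility number of complete bipartite graphs\<close>

text \<open>The one or two vertices of \<open>U\<close> become long bars below and above those of
  \<open>W\<close>, which stand side by side. One bar per vertex suffices here, whereas
  \<open>ex_dissection\<close> asks for \<open>t \<ge> 2\<close>.\<close>

lemma rep_small_side:
  fixes G :: "('a, 'b) pre_digraph"
  assumes V: "verts G = U \<union> W" "U \<inter> W = {}" "finite W" "W \<noteq> {}" and arcs: "arcs_ends G = U \<times> W \<union> W \<times> U"
    and U: "card U = 1 \<or> card U = 2"
  shows "\<exists>f. bar_visibility_rep 1 G f"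
proof -
  obtain ws where ws: "set ws = W" "distinct ws" using finite_distinct_list[OF V(3)] by blast
  define n where "n = length ws"
  have n0: "0 < n" using V(4) ws by (auto simp: n_def)
  obtain a bs where ab: "U = insert a (set bs)" "distinct (a # bs)" "length bs \<le> 1"
  proof -
    from U consider a where "U = {a}" | a b where "U = {a, b}" "a \<noteq> b"
      by (auto simp: card_1_singleton_iff card_2_iff)
    then show ?thesis
    proof cases
      case (1 a) then show ?thesis using that[of a "[]"] by simp
    next
      case (2 a b) then show ?thesis using that[of a "[b]"] by simp
    qed
  qed
  define e where "e = (if bs = [] then [] else [Suc n])"
  define hl where "hl = a # ws @ bs"
  define cs where "cs = map (\<lambda>k. [0, Suc k] @ e) [0..<n]"
  have len: "length hl = Suc (n + length bs)" by (simp add: hl_def n_def)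
  have bs: "bs = [] \<or> (\<exists>b. bs = [b])" using ab(3) by (cases bs) auto
  have hl0: "hl ! 0 = a" "\<And>k. k < n \<Longrightarrow> hl ! Suc k = ws ! k" "\<And>b. bs = [b] \<Longrightarrow> hl ! Suc n = b"
    by (auto simp: hl_def n_def nth_append)
  have csE: "\<exists>k<n. c = [0, Suc k] @ e" if "c \<in> set cs" for c using that by (auto simp: cs_def)
  have wsW: "ws ! k \<in> W" if "k < n" for k using ws that by (auto simp: n_def)
  show ?thesis
  proof (rule layout_rep[of cs hl])
    fix c assume "c \<in> set cs"
    then obtain k where k: "k < n" "c = [0, Suc k] @ e" using csE by blast
    then show "sorted_wrt (<) c" by (auto simp: e_def)
    fix v assume "v \<in> set c"
    then show "v < length hl" using k len by (auto simp: e_def split: if_splits)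
  next
    fix v assume v: "v < length hl"
    consider "v = 0" | k where "v = Suc k" "k < n" | "v = Suc n" "bs \<noteq> []"
      using v bs unfolding len by (cases v) (fastforce simp: less_Suc_eq)+
    then show "\<exists>c\<in>set cs. v \<in> set c"
      using n0 by cases (auto simp: cs_def e_def)
  next
    fix v i j k assume *: "i \<le> j" "j \<le> k" "k < length cs" "v \<in> set (cs ! i)" "v \<in> set (cs ! k)"
    then show "v \<in> set (cs ! j)" by (auto simp: cs_def e_def split: if_splits)
  next
    fix xs u v ys assume "xs @ [u, v] @ ys \<in> set cs"
    then obtain k where k: "k < n" "xs @ [u, v] @ ys = [0, Suc k] @ e" using csE by blast
    then have "u = 0 \<and> v = Suc k \<or> u = Suc k \<and> v = Suc n \<and> bs \<noteq> []"
      by (auto simp: e_def Cons_eq_append_conv append_eq_Cons_conv split: if_splits)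
    then have "hl ! u \<in> U \<and> hl ! v \<in> W \<or> hl ! u \<in> W \<and> hl ! v \<in> U"
      using hl0 bs ab(1) wsW[OF k(1)] k(1) by auto
    then show "hl ! u \<rightarrow>\<^bsub>G\<^esub> hl ! v \<and> hl ! v \<rightarrow>\<^bsub>G\<^esub> hl ! u" by (auto simp: arcs)
  next
    fix x y assume "x \<rightarrow>\<^bsub>G\<^esub> y"
    then obtain u w where uw: "u \<in> U" "w \<in> W" "x = u \<and> y = w \<or> x = w \<and> y = u" by (auto simp: arcs)
    obtain k where k: "k < n" "ws ! k = w" using uw(2) ws by (auto simp: n_def in_set_conv_nth)
    have c: "[0, Suc k] @ e \<in> set cs" using k by (auto simp: cs_def)
    consider "u = a" | "bs = [u]" using uw(1) ab(1) bs by auto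
    then have "\<exists>xs i j ys. xs @ [i, j] @ ys \<in> set cs \<and> (hl ! i = u \<and> hl ! j = w \<or> hl ! i = w \<and> hl ! j = u)"
    proof cases
      case 1
      then show ?thesis using c k hl0 by (intro exI[of _ "[]"] exI[of _ 0] exI[of _ "Suc k"] exI[of _ e]) auto
    next
      case 2
      then have "[0] @ [Suc k, Suc n] @ [] \<in> set cs" using c by (simp add: e_def)
      then show ?thesis using k hl0 2 by blast
    qed
    then show "\<exists>xs u v ys. xs @ [u, v] @ ys \<in> set cs \<and> (hl ! u = x \<and> hl ! v = y \<or> hl ! u = y \<and> hl ! v = x)"
      using uw(3) by metis
  next
    fix w assume "w \<in> verts G"
    have "distinct hl" using ws(2) ab(2) V(2) ws(1) ab(1) by (auto simp: hl_def)
    then have "i = j" if "i < length hl" "hl ! i = w" "j < length hl" "hl ! j = w" for i j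
      using that nth_eq_iff_index_eq by metis
    then have "card {i. i < length hl \<and> hl ! i = w} \<le> Suc 0" by (subst card_le_Suc0_iff_eq) auto
    then show "card {i. i < length hl \<and> hl ! i = w} \<le> 1" by simp
  next
    show "set hl \<subseteq> verts G" using V(1) ws(1) ab(1) by (auto simp: hl_def)
  qed
qed

lemma items_subset:
  "set_mset (corners d) \<subseteq> C \<Longrightarrow> set_mset (polygons d) \<subseteq> P \<Longrightarrow> set (items d) \<subseteq> Cor ` C \<union> Lo ` P \<union> Hi ` P"
  by (induction d) auto

lemma rep_mono: "bar_visibility_rep t G f \<Longrightarrow> t \<le> t' \<Longrightarrow> bar_visibility_rep t' G f"
  unfolding bar_visibility_rep_def by (meson order_trans)

lemma rep_upper_bound:
  fixes G :: "('a, 'b) pre_digraph"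
  assumes V: "verts G = U \<union> W" "U \<inter> W = {}" "card U = m" "card W = 2 * p" "0 < m" "0 < p"
    and arcs: "arcs_ends G = U \<times> W \<union> W \<times> U"
    and t: "0 < t" "m * p + 2 \<le> t * m + 2 * (t * p)"
  shows "\<exists>f. bar_visibility_rep t G f"
proof -
  have fin: "finite U" "finite W" and ne: "U \<noteq> {}" "W \<noteq> {}"
    using V(3-6) by (auto intro: card_ge_0_finite)
  consider "m \<le> 2" | "p = 1" | "3 \<le> m" "2 \<le> p" using V(6) by linarith
  then show ?thesis
  proof cases
    case 1
    then have "card U = 1 \<or> card U = 2" using V(3,5) by auto
    from rep_small_side[OF V(1,2) fin(2) ne(2) arcs this]
    obtain f where "bar_visibility_rep 1 G f" by (rule exE)
    then have "bar_visibility_rep t G f" by (rule rep_mono) (use t(1) in simp)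
    then show ?thesis by blast
  next
    case 2
    then have "card W = 1 \<or> card W = 2" using V(4) by auto
    moreover have "verts G = W \<union> U" "W \<inter> U = {}" "arcs_ends G = W \<times> U \<union> U \<times> W" using V(1,2) arcs by auto
    ultimately have "\<exists>f. bar_visibility_rep 1 G f" using fin(1) ne(1) by (intro rep_small_side)
    then obtain f where "bar_visibility_rep 1 G f" by (rule exE)
    then have "bar_visibility_rep t G f" by (rule rep_mono) (use t(1) in simp)
    then show ?thesis by blast
  next
    case 3
    \<comment> \<open>For \<open>t = 1\<close> the bound reads
      \<open>(m - 2) (p - 1) \<le> 0\<close>.\<close>
    have "t \<noteq> 1"
    proof
      assume "t = 1"
      then have *: "m * p + 2 \<le> m + 2 * p" using t(2) by simp
      obtain m' p' where "m = 3 + m'" "p = 2 + p'" using 3 by (metis le_Suc_ex)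
      with * show False by (simp add: algebra_simps)
    qed
    then have "2 \<le> int t" using t(1) by linarith
    moreover have "int m * int p + 2 \<le> int t * int m + 2 * (int t * int p)"
      using t(2) by (metis (no_types, lifting) of_nat_add of_nat_le_iff of_nat_mult of_nat_numeral)
    moreover have "2 \<le> int m" "1 \<le> int p" using 3 by auto
    ultimately obtain d where d: "chordal d" "set_mset (corners d) \<subseteq> {0..<int m}" "set_mset (polygons d) \<subseteq> {0..<int p}"
      "\<forall>z\<in>{0..<int m}. int (count (add_mset (1 mod int m) (add_mset (2 mod int m) (corners d))) z) \<le> int t"
      "\<forall>q\<in>{0..<int p}. int (count (polygons d) q) \<le> int t"
      "{0..<int m} \<times> {0..<int p} \<subseteq> cells undefined (1 mod int m) (2 mod int m) d"
      using ex_dissection[of "int m" "int p" "int t"] by blast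
    \<comment> \<open>A nonempty set of incidences excludes \<open>Side\<close>, so the dissection
      starts with a polygon.\<close>
    have "(0, 0) \<in> {0..<int m} \<times> {0..<int p}" using 3 by simp
    then have "cells undefined (1 mod int m) (2 mod int m) d \<noteq> {}" using d(6) by blast
    then obtain j s where ds: "d = Polygon j s" using d(1) by (cases d) auto
    let ?C = "{0..<int m}" and ?P = "{0..<int p}"
    obtain \<alpha> where \<alpha>: "bij_betw \<alpha> ?C U" using finite_same_card_bij[of ?C U] fin V(3) by auto
    obtain h where h: "bij_betw h {0..<2 * int p} W" using finite_same_card_bij[of "{0..<2 * int p}" W] fin V(4)
      by (auto simp: nat_mult_distrib)
    \<comment> \<open>The two copies of a polygon labelled \<open>q\<close>, one on each side of the
      circle, represent the vertices numbered \<open>q\<close> and \<open>q + p\<close> of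
      \<open>W\<close>.\<close>
    define g where "g i = (case i of Cor z \<Rightarrow> \<alpha> z | Lo q \<Rightarrow> h q | Hi q \<Rightarrow> h (q + int p))" for i
    have gC: "g ` Cor ` ?C = U" using \<alpha> by (simp add: image_image g_def bij_betw_def)
    have split: "{0..<2 * int p} = ?P \<union> (\<lambda>q. q + int p) ` ?P"
      by (auto simp: image_iff intro: bexI[of _ "_ - int p"])
    have gP: "g ` (Lo ` ?P \<union> Hi ` ?P) = W"
    proof -
      have "g ` (Lo ` ?P \<union> Hi ` ?P) = h ` ?P \<union> h ` ((\<lambda>q. q + int p) ` ?P)"
        unfolding image_Un image_image by (simp add: g_def)
      also have "\<dots> = h ` {0..<2 * int p}" unfolding split image_Un ..
      finally show ?thesis using h by (simp add: bij_betw_def)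
    qed
    show ?thesis
    proof (rule dissection_rep[where U = U and W = W and g = g and C = ?C and P = ?P and x = "1 mod int m" and y = "2 mod int m" and j = j and s = s])
      show "inj_on g (Cor ` ?C \<union> Lo ` ?P \<union> Hi ` ?P)"
      proof (rule inj_onI)
        fix i k assume i: "i \<in> Cor ` ?C \<union> Lo ` ?P \<union> Hi ` ?P" and k: "k \<in> Cor ` ?C \<union> Lo ` ?P \<union> Hi ` ?P" and eq: "g i = g k"
        have U: "g i \<in> U \<longleftrightarrow> isCor i" if "i \<in> Cor ` ?C \<union> Lo ` ?P \<union> Hi ` ?P" for i
        proof (cases "isCor i")
          case True
          then have "i \<in> Cor ` ?C" using that by auto
          then show ?thesis using gC True by blast
        next
          case False
          then have "i \<in> Lo ` ?P \<union> Hi ` ?P" using that by auto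
          then have "g i \<in> W" using gP by blast
          then show ?thesis using V(2) False by blast
        qed
        have injh: "x = y" if "h x = h y" "x \<in> {0..<2 * int p}" "y \<in> {0..<2 * int p}" for x y
          using h that unfolding bij_betw_def inj_on_def by blast
        show "i = k"
        proof (cases "isCor i")
          case True
          then obtain z w where "i = Cor z" "k = Cor w" "z \<in> ?C" "w \<in> ?C" using U[OF i] U[OF k] eq i k by auto
          then show ?thesis using eq \<alpha> by (auto simp: g_def bij_betw_def inj_on_def)
        next
          case False
          then have "\<not> isCor k" using U[OF i] U[OF k] eq by simp
          then obtain q r where qr: "i = Lo q \<or> i = Hi q" "k = Lo r \<or> k = Hi r" "q \<in> ?P" "r \<in> ?P"
            using False i k by auto
          show ?thesis using qr eq injh[of q r] injh[of "q + int p" r] injh[of q "r + int p"] injh[of "q + int p" "r + int p"]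
            by (auto simp: g_def)
        qed
      qed
      show "set (Cor (1 mod int m) # items (Polygon j s) @ [Cor (2 mod int m)]) \<subseteq> Cor ` ?C \<union> Lo ` ?P \<union> Hi ` ?P"
        using items_subset[OF d(2,3)] 3 ds by auto
      show "?C \<times> ?P \<subseteq> cells undefined (1 mod int m) (2 mod int m) (Polygon j s)" using d(6) ds by simp
      show "count (add_mset (1 mod int m) (add_mset (2 mod int m) (corners s))) z \<le> t" if "z \<in> ?C" for z
        using bspec[OF d(4) that] ds by simp
      show "count (polygons (Polygon j s)) i \<le> t" if "i \<in> ?P" for i
        using bspec[OF d(5) that] ds by simp
    qed (use V(1) arcs gC gP in auto)
  qed
qed

theorem theorem13:
  fixes m n :: nat and G :: "('a, 'b) pre_digraph"
  assumes "m > 0" and "n > 0" and "even n"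
    and "K\<^bsub>m,n\<^esub> G"
  shows "int (bar_visibility_number G) = \<lceil>(real m * real n + 4) / (2 * real m + 2 * real n)\<rceil>"
proof -
  from assms(4) obtain U W where UW: "verts G = U \<union> W" "U \<inter> W = {}" "card U = m" "card W = n"
    "arcs_ends G = U \<times> W \<union> W \<times> U"
    unfolding complete_bipartite_digraph_def by blast
  obtain p where p: "n = 2 * p" using assms(3) by (elim evenE)
  define x where "x = (real m * real n + 4) / (2 * real m + 2 * real n)"
  define T where "T = nat \<lceil>x\<rceil>"
  have den: "0 < 2 * real m + 2 * real n" using assms(1) by simp
  have x0: "0 < x" unfolding x_def by (intro divide_pos_pos den) (simp add: add_nonneg_pos)
  have x_le: "x \<le> real t \<longleftrightarrow> m * n + 4 \<le> 2 * (t * (m + n))" for t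
  proof -
    have "x \<le> real t \<longleftrightarrow> real m * real n + 4 \<le> real t * (2 * real m + 2 * real n)"
      unfolding x_def by (rule pos_divide_le_eq[OF den])
    also have "\<dots> \<longleftrightarrow> real (m * n + 4) \<le> real (2 * (t * (m + n)))" by (simp add: algebra_simps)
    finally show ?thesis by (simp only: of_nat_le_iff)
  qed
  have fin: "finite U" "finite W" and ne: "U \<noteq> {}" "W \<noteq> {}"
    using UW assms(1,2) by (auto intro: card_ge_0_finite)
  have "\<exists>f. bar_visibility_rep T G f"
  proof (rule rep_upper_bound[OF UW(1-3) _ assms(1) _ UW(5)])
    show "card W = 2 * p" "0 < p" using UW(4) p assms(2) by auto
    show "0 < T" using x0 by (simp add: T_def)
    have "x \<le> real T" using x0 by (simp add: T_def real_nat_ceiling_ge)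
    then show "m * p + 2 \<le> T * m + 2 * (T * p)" unfolding x_le p by (simp add: algebra_simps)
  qed
  moreover have "T \<le> t" if ex: "\<exists>f. bar_visibility_rep t G f" for t
  proof -
    obtain f where f: "bar_visibility_rep t G f" using ex by (rule exE)
    have "u \<rightarrow>\<^bsub>G\<^esub> w" if "u \<in> U" "w \<in> W" for u w using UW(5) that by auto
    from rep_lower_bound[OF f UW(1,2) fin ne this] have "m * n + 3 \<le> 2 * (t * (m + n))"
      unfolding UW(3,4) .
    moreover obtain k where "m * n = 2 * k" using assms(3) by (metis dvd_mult evenE)
    moreover have "2 * k + 3 \<le> 2 * r \<Longrightarrow> 2 * k + 4 \<le> 2 * r" for r by presburger
    ultimately have "m * n + 4 \<le> 2 * (t * (m + n))" by simp
    then have "x \<le> real t" unfolding x_le .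
    then show ?thesis by (simp add: T_def ceiling_le_iff)
  qed
  ultimately have "bar_visibility_number G = T"
    unfolding bar_visibility_number_def by (rule Least_equality)
  then show ?thesis using x0 by (simp add: T_def x_def)
qed

end
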